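(* Let $X$ be a locally compact Hausdorff topological space and let $A$ be a $*$-subalgebra of $C(X)$ which contains the constant function $1$ and separates the points of $X$. Let $\mu$ be a positive regular Borel measure on $X$ such that $A\subseteq L^1(X,\mu)$ and let $\eta,\xi\in L^\infty(X,\mu)$ be nonnegative functions. Define positive linear functionals $f_\eta$ and $f_\xi$ on $A$ by $$f_\eta(a)=\int_X a(x)\eta(x)\,d\mu(x),\qquad f_\xi(a)=\int_X a(x)\xi(x)\,d\mu(x)\qquad\text{for } a\in A.$$ Suppose that the GNS representations $\pi_{f_\eta}$ and $\pi_{f_\xi}$ are essentially self-adjoint. Then $$P_A(f_\eta,f_\xi)=\left(\int_X \eta(x)^{1/2}\,\xi(x)^{1/2}\,d\mu(x)\right)^2 .$$
   Context: $C(X)$ is the $*$-algebra of all continuous complex-valued functions on $X$ (not necessarily bounded) with involution $a^+=\overline a$ (complex conjugation). For a complex unital $*$-algebra $A$ with involution $a\mapsto a^+$, a linear functional $f$ is positive if $f(a^+a)\ge 0$ for all $a\in A$; $\mathcal P(A)$ is the set of positive linear functionals. Inner products are linear in the first variable. A $*$-representation $\pi$ of $A$ on a complex inner product space $\mathcal D(\pi)$ with Hilbert space completion $\mathcal H(\pi)$ is an algebra homomorphism of $A$ into the linear operators $\mathcal D(\pi)\to\mathcal D(\pi)$ with $\pi(1)=I$ and $\langle\pi(a)\varphi,\psi\rangle=\langle\varphi,\pi(a^+)\psi\rangle$ for $a\in A$, $\varphi,\psi\in\mathcal D(\pi)$. The operators $\pi(a)$ may be unbounded. Adjoint representation: $\mathcal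 D(\pi^* )=\bigcap_{a\in A}\mathcal D(\pi(a)^* )$, $\pi^*(a)=\pi(a^+)^*\lceil\mathcal D(\pi^* )$. Biclosure: $\mathcal D(\pi^{**})=\bigcap_{a\in A}\mathcal D(\pi^*(a)^* )$, $\pi^{**}(a)=\pi^*(a^+)^*\lceil\mathcal D(\pi^{**})$. $\pi$ is called essentially self-adjoint if $\pi^*=\pi^{**}$ (equivalently $\mathcal D(\pi^{**})=\mathcal D(\pi^* )$). GNS representation: for $f\in\mathcal P(A)$, $\pi_f$ is the (up to unitary equivalence unique) $*$-representation with a vector $\varphi_f$ such that $\mathcal D(\pi_f)=\pi_f(A)\varphi_f$ and $f(a)=\langle\pi_f(a)\varphi_f,\varphi_f\rangle$ for all $a\in A$. For a $*$-representation $\pi$ and $f\in\mathcal P(A)$, $S(\pi,f)$ is the set of all $\varphi\in\mathcal D(\pi)$ with $f(a)=\langle\pi(a)\varphi,\varphi\rangle$ for all $a\in A$. The transition probability of $f,g\in\mathcal P(A)$ is $$P_A(f,g)=\sup_{\pi}\ \sup_{\varphi\in S(\pi,f),\,\psi\in S(\pi,g)}|\langle\varphi,\psi\rangle|^2,$$ where $\pi$ ranges over all $*$-representations of $A$. *)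

theory Defs
  imports "HOL-Analysis.Analysis" "HOL-Algebra.Algebraic_Closure_Type"
begin

section \<open>Complex inner product spaces\<close>

text \<open>
  The spaces are carrier-based, because a transition probability is a supremum over
  representations on arbitrary inner product spaces. The multiplication and unit fields
  inherited from the record \<open>module\<close> are irrelevant.
\<close>

abbreviation complex_ring :: "complex ring" where
  "complex_ring \<equiv> ring_of_type_algebra"

record 'v ip_space = "(complex, 'v) module" +
  ip :: "'v \<Rightarrow> 'v \<Rightarrow> complex"

locale complex_ip_space = Module.module complex_ring V for V :: "('v, 'm) ip_space_scheme" +
  assumes ip_add_left: "\<lbrakk>u \<in> carrier V; v \<in> carrier V; w \<in> carrier V\<rbrakk>
      \<Longrightarrow> ip V (u \<oplus>\<^bsub>V\<^esub> v) w = ip V u w + ip V v w"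
    and ip_smult_left: "\<lbrakk>v \<in> carrier V; w \<in> carrier V\<rbrakk>
      \<Longrightarrow> ip V (c \<odot>\<^bsub>V\<^esub> v) w = c * ip V v w"
    and ip_cnj: "\<lbrakk>v \<in> carrier V; w \<in> carrier V\<rbrakk> \<Longrightarrow> ip V w v = cnj (ip V v w)"
    and ip_nonneg: "v \<in> carrier V \<Longrightarrow> ip V v v \<in> \<real>\<^sub>\<ge>\<^sub>0"
    and ip_definite: "\<lbrakk>v \<in> carrier V; ip V v v = 0\<rbrakk> \<Longrightarrow> v = \<zero>\<^bsub>V\<^esub>"

definition ip_norm :: "('v, 'm) ip_space_scheme \<Rightarrow> 'v \<Rightarrow> real" where
  "ip_norm V v = sqrt (Re (ip V v v))"

text \<open>The distance is set to 0 off the carrier, since \<open>Metric_space\<close> demands that it be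
  nonnegative and symmetric on the whole type.\<close>

definition ip_dist :: "('v, 'm) ip_space_scheme \<Rightarrow> 'v \<Rightarrow> 'v \<Rightarrow> real" where
  "ip_dist V v w =
     (if v \<in> carrier V \<and> w \<in> carrier V then ip_norm V (v \<ominus>\<^bsub>V\<^esub> w) else 0)"

definition hilbert_space :: "('v, 'm) ip_space_scheme \<Rightarrow> bool" where
  "hilbert_space H \<longleftrightarrow>
     complex_ip_space H \<and> Metric_space.mcomplete (carrier H) (ip_dist H)"

text \<open>Up to unitary equivalence, the completion of \<open>V\<close> is a Hilbert space containing \<open>V\<close>
  as a dense subspace.\<close>

definition hilbert_completion ::
  "('v, 'm) ip_space_scheme \<Rightarrow> ('v, 'm) ip_space_scheme \<Rightarrow> bool" where
  "hilbert_completion V H \<longleftrightarrow>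
     complex_ip_space V \<and> hilbert_space H \<and> carrier V \<subseteq> carrier H \<and>
     \<zero>\<^bsub>V\<^esub> = \<zero>\<^bsub>H\<^esub> \<and>
     (\<forall>v\<in>carrier V. \<forall>w\<in>carrier V. v \<oplus>\<^bsub>V\<^esub> w = v \<oplus>\<^bsub>H\<^esub> w \<and> ip V v w = ip H v w) \<and>
     (\<forall>c. \<forall>v\<in>carrier V. c \<odot>\<^bsub>V\<^esub> v = c \<odot>\<^bsub>H\<^esub> v) \<and>
     (Metric_space.mtopology (carrier H) (ip_dist H)) closure_of (carrier V) = carrier H"

section \<open>Unital *-algebras and positive functionals\<close>

record 'a star_algebra = "(complex, 'a) module" +
  star :: "'a \<Rightarrow> 'a"

locale star_algebra = Module.module complex_ring A + Ring.ring A
  for A :: "('a, 'm) star_algebra_scheme" +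
  assumes smult_mult_left: "\<lbrakk>a \<in> carrier A; b \<in> carrier A\<rbrakk>
      \<Longrightarrow> (c \<odot>\<^bsub>A\<^esub> a) \<otimes>\<^bsub>A\<^esub> b = c \<odot>\<^bsub>A\<^esub> (a \<otimes>\<^bsub>A\<^esub> b)"
    and smult_mult_right: "\<lbrakk>a \<in> carrier A; b \<in> carrier A\<rbrakk>
      \<Longrightarrow> a \<otimes>\<^bsub>A\<^esub> (c \<odot>\<^bsub>A\<^esub> b) = c \<odot>\<^bsub>A\<^esub> (a \<otimes>\<^bsub>A\<^esub> b)"
    and star_closed: "a \<in> carrier A \<Longrightarrow> star A a \<in> carrier A"
    and star_star: "a \<in> carrier A \<Longrightarrow> star A (star A a) = a"
    and star_add: "\<lbrakk>a \<in> carrier A; b \<in> carrier A\<rbrakk>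
      \<Longrightarrow> star A (a \<oplus>\<^bsub>A\<^esub> b) = star A a \<oplus>\<^bsub>A\<^esub> star A b"
    and star_smult: "a \<in> carrier A \<Longrightarrow> star A (c \<odot>\<^bsub>A\<^esub> a) = cnj c \<odot>\<^bsub>A\<^esub> star A a"
    and star_mult: "\<lbrakk>a \<in> carrier A; b \<in> carrier A\<rbrakk>
      \<Longrightarrow> star A (a \<otimes>\<^bsub>A\<^esub> b) = star A b \<otimes>\<^bsub>A\<^esub> star A a"

definition star_subalgebra :: "'a set \<Rightarrow> ('a, 'm) star_algebra_scheme \<Rightarrow> bool" where
  "star_subalgebra S A \<longleftrightarrow> S \<subseteq> carrier A \<and> \<zero>\<^bsub>A\<^esub> \<in> S \<and>
     (\<forall>a\<in>S. \<forall>b\<in>S. a \<oplus>\<^bsub>A\<^esub> b \<in> S \<and> a \<otimes>\<^bsub>A\<^esub> b \<in> S) \<and>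
     (\<forall>c. \<forall>a\<in>S. c \<odot>\<^bsub>A\<^esub> a \<in> S) \<and> (\<forall>a\<in>S. star A a \<in> S)"

definition positive_functionals ::
  "('a, 'm) star_algebra_scheme \<Rightarrow> ('a \<Rightarrow> complex) set" where
  "positive_functionals A = {f.
     (\<forall>a\<in>carrier A. \<forall>b\<in>carrier A. f (a \<oplus>\<^bsub>A\<^esub> b) = f a + f b) \<and>
     (\<forall>c. \<forall>a\<in>carrier A. f (c \<odot>\<^bsub>A\<^esub> a) = c * f a) \<and>
     (\<forall>a\<in>carrier A. f (star A a \<otimes>\<^bsub>A\<^esub> a) \<in> \<real>\<^sub>\<ge>\<^sub>0)}"

section \<open>*-representations by possibly unbounded operators\<close>

locale star_rep = A: star_algebra A + V: complex_ip_space V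
  for A :: "('a, 'm) star_algebra_scheme" and V :: "('v, 'n) ip_space_scheme"
    and \<pi> :: "'a \<Rightarrow> 'v \<Rightarrow> 'v" +
  assumes rep_closed: "\<lbrakk>a \<in> carrier A; v \<in> carrier V\<rbrakk> \<Longrightarrow> \<pi> a v \<in> carrier V"
    and rep_vec_add: "\<lbrakk>a \<in> carrier A; v \<in> carrier V; w \<in> carrier V\<rbrakk>
      \<Longrightarrow> \<pi> a (v \<oplus>\<^bsub>V\<^esub> w) = \<pi> a v \<oplus>\<^bsub>V\<^esub> \<pi> a w"
    and rep_vec_smult: "\<lbrakk>a \<in> carrier A; v \<in> carrier V\<rbrakk>
      \<Longrightarrow> \<pi> a (c \<odot>\<^bsub>V\<^esub> v) = c \<odot>\<^bsub>V\<^esub> \<pi> a v"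
    and rep_add: "\<lbrakk>a \<in> carrier A; b \<in> carrier A; v \<in> carrier V\<rbrakk>
      \<Longrightarrow> \<pi> (a \<oplus>\<^bsub>A\<^esub> b) v = \<pi> a v \<oplus>\<^bsub>V\<^esub> \<pi> b v"
    and rep_smult: "\<lbrakk>a \<in> carrier A; v \<in> carrier V\<rbrakk> \<Longrightarrow> \<pi> (c \<odot>\<^bsub>A\<^esub> a) v = c \<odot>\<^bsub>V\<^esub> \<pi> a v"
    and rep_mult: "\<lbrakk>a \<in> carrier A; b \<in> carrier A; v \<in> carrier V\<rbrakk>
      \<Longrightarrow> \<pi> (a \<otimes>\<^bsub>A\<^esub> b) v = \<pi> a (\<pi> b v)"
    and rep_one: "v \<in> carrier V \<Longrightarrow> \<pi> \<one>\<^bsub>A\<^esub> v = v"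
    and rep_star: "\<lbrakk>a \<in> carrier A; v \<in> carrier V; w \<in> carrier V\<rbrakk>
      \<Longrightarrow> ip V (\<pi> a v) w = ip V v (\<pi> (star A a) w)"

text \<open>\<open>adjoint_dom H D T\<close> and \<open>adjoint_op H D T\<close> are the domain and the action of the Hilbert
  space adjoint of a densely defined operator \<open>T\<close> with domain \<open>D\<close>; density makes the
  description in \<open>adjoint_op\<close> unique.\<close>

definition adjoint_dom :: "('v, 'm) ip_space_scheme \<Rightarrow> 'v set \<Rightarrow> ('v \<Rightarrow> 'v) \<Rightarrow> 'v set" where
  "adjoint_dom H D T =
     {\<psi> \<in> carrier H. \<exists>\<zeta>\<in>carrier H. \<forall>\<phi>\<in>D. ip H (T \<phi>) \<psi> = ip H \<phi> \<zeta>}"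

definition adjoint_op :: "('v, 'm) ip_space_scheme \<Rightarrow> 'v set \<Rightarrow> ('v \<Rightarrow> 'v) \<Rightarrow> 'v \<Rightarrow> 'v" where
  "adjoint_op H D T \<psi> =
     (THE \<zeta>. \<zeta> \<in> carrier H \<and> (\<forall>\<phi>\<in>D. ip H (T \<phi>) \<psi> = ip H \<phi> \<zeta>))"

text \<open>A family of operators is given by its common domain \<open>D\<close> and its action \<open>\<pi>\<close>.
  Applying the following two constructions twice yields the biclosure.\<close>

definition adjoint_rep_dom :: "('a, 'm) star_algebra_scheme \<Rightarrow> ('v, 'n) ip_space_scheme
    \<Rightarrow> 'v set \<Rightarrow> ('a \<Rightarrow> 'v \<Rightarrow> 'v) \<Rightarrow> 'v set" where
  "adjoint_rep_dom A H D \<pi> = (\<Inter>a\<in>carrier A. adjoint_dom H D (\<pi> a))"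

definition adjoint_rep :: "('a, 'm) star_algebra_scheme \<Rightarrow> ('v, 'n) ip_space_scheme
    \<Rightarrow> 'v set \<Rightarrow> ('a \<Rightarrow> 'v \<Rightarrow> 'v) \<Rightarrow> 'a \<Rightarrow> 'v \<Rightarrow> 'v" where
  "adjoint_rep A H D \<pi> a = adjoint_op H D (\<pi> (star A a))"

definition essentially_self_adjoint :: "('a, 'm) star_algebra_scheme
    \<Rightarrow> ('v, 'n) ip_space_scheme \<Rightarrow> ('v, 'n) ip_space_scheme \<Rightarrow> ('a \<Rightarrow> 'v \<Rightarrow> 'v) \<Rightarrow> bool" where
  "essentially_self_adjoint A V H \<pi> \<longleftrightarrow>
     (let D1 = adjoint_rep_dom A H (carrier V) \<pi>;
          \<pi>1 = adjoint_rep A H (carrier V) \<pi>;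
          D2 = adjoint_rep_dom A H D1 \<pi>1;
          \<pi>2 = adjoint_rep A H D1 \<pi>1
      in D1 = D2 \<and> (\<forall>a\<in>carrier A. \<forall>\<phi>\<in>D1. \<pi>1 a \<phi> = \<pi>2 a \<phi>))"

definition gns_rep :: "('a, 'm) star_algebra_scheme \<Rightarrow> ('a \<Rightarrow> complex)
    \<Rightarrow> ('v, 'n) ip_space_scheme \<Rightarrow> ('a \<Rightarrow> 'v \<Rightarrow> 'v) \<Rightarrow> 'v \<Rightarrow> bool" where
  "gns_rep A f V \<pi> \<phi> \<longleftrightarrow>
     star_rep A V \<pi> \<and> \<phi> \<in> carrier V \<and> carrier V = (\<lambda>a. \<pi> a \<phi>) ` carrier A \<and>
     (\<forall>a\<in>carrier A. f a = ip V (\<pi> a \<phi>) \<phi>)"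

section \<open>Transition probability\<close>

definition representing_vectors :: "('a, 'm) star_algebra_scheme
    \<Rightarrow> ('v, 'n) ip_space_scheme \<Rightarrow> ('a \<Rightarrow> 'v \<Rightarrow> 'v) \<Rightarrow> ('a \<Rightarrow> complex) \<Rightarrow> 'v set" where
  "representing_vectors A V \<pi> f =
     {\<phi> \<in> carrier V. \<forall>a\<in>carrier A. f a = ip V (\<pi> a \<phi>) \<phi>}"

text \<open>
  HOL cannot quantify over all types inside a formula, so the supremum is taken over the
  representations on inner product spaces whose carrier lies in a given type \<open>'v\<close>.
  For \<open>'v\<close> of the form \<open>'a + 'w\<close> with \<open>'w\<close> arbitrary, this covers the spaces carried by
  any type \<open>'w\<close> together with those carried by the type of the algebra elements. The latter
  suffice for the supremum over all spaces: \<open>\<phi>\<close> and \<open>\<psi>\<close> lie in the subrepresentation on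
  \<open>\<pi>(A)\<phi> + \<pi>(A)\<psi>\<close>, which has at most as many elements as \<open>A\<close>.
  The extended reals avoid a default value for empty or unbounded sets.
\<close>

definition transition_probability :: "'v itself \<Rightarrow> ('a, 'm) star_algebra_scheme
    \<Rightarrow> ('a \<Rightarrow> complex) \<Rightarrow> ('a \<Rightarrow> complex) \<Rightarrow> ereal" where
  "transition_probability _ A f g =
     Sup {ereal ((cmod (ip V \<phi> \<psi>))\<^sup>2) | (V :: 'v ip_space) \<pi> \<phi> \<psi>.
       star_rep A V \<pi> \<and> \<phi> \<in> representing_vectors A V \<pi> f \<and>
       \<psi> \<in> representing_vectors A V \<pi> g}"

section \<open>Algebras of continuous functions, measures, and functionals\<close>

definition cont_functions :: "('x::topological_space \<Rightarrow> complex) star_algebra" where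
  "cont_functions =
     \<lparr>carrier = {a. continuous_on UNIV a},
      monoid.mult = (\<lambda>a b x. a x * b x), one = (\<lambda>x. 1),
      ring.zero = (\<lambda>x. 0), add = (\<lambda>a b x. a x + b x),
      smult = (\<lambda>c a x. c * a x), star = (\<lambda>a x. cnj (a x))\<rparr>"

definition regular_borel_measure :: "'x::topological_space measure \<Rightarrow> bool" where
  "regular_borel_measure \<mu> \<longleftrightarrow> sets \<mu> = sets borel \<and>
     (\<forall>E\<in>sets borel.
        emeasure \<mu> E = (INF U\<in>{U. E \<subseteq> U \<and> open U}. emeasure \<mu> U) \<and>
        emeasure \<mu> E = (SUP K\<in>{K. K \<subseteq> E \<and> compact K}. emeasure \<mu> K))"

definition L_infinity :: "'x measure \<Rightarrow> ('x \<Rightarrow> real) set" where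
  "L_infinity \<mu> = {h \<in> borel_measurable \<mu>. \<exists>C. AE x in \<mu>. \<bar>h x\<bar> \<le> C}"

definition density_functional ::
  "'x measure \<Rightarrow> ('x \<Rightarrow> real) \<Rightarrow> ('x \<Rightarrow> complex) \<Rightarrow> complex" where
  "density_functional \<mu> h a = (\<integral>x. a x * complex_of_real (h x) \<partial>\<mu>)"

section \<open>Well-definedness\<close>

lemma (in complex_ip_space) ip_norm_triangle:
  assumes u: "u \<in> carrier V" and v: "v \<in> carrier V"
  shows "ip_norm V (u \<oplus>\<^bsub>V\<^esub> v) \<le> ip_norm V u + ip_norm V v"
proof -
  have sm: "c \<odot>\<^bsub>V\<^esub> w \<in> carrier V" if "w \<in> carrier V" for c w
    using that smult_closed by (simp add: ring_of_type_algebra_def)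
  have addr: "ip V x (y \<oplus>\<^bsub>V\<^esub> z) = ip V x y + ip V x z"
    if "x \<in> carrier V" "y \<in> carrier V" "z \<in> carrier V" for x y z
    using that by (metis ip_cnj ip_add_left M.a_closed complex_cnj_add)
  have smr: "ip V x (c \<odot>\<^bsub>V\<^esub> y) = cnj c * ip V x y"
    if "x \<in> carrier V" "y \<in> carrier V" for x y c
    using that sm by (metis ip_cnj ip_smult_left complex_cnj_mult)
  have nn: "0 \<le> Re (ip V w w)" "Im (ip V w w) = 0" if "w \<in> carrier V" for w
    using ip_nonneg[OF that] by (auto simp: nonneg_Reals_def)
  define z where "z = ip V u v"
  have zc: "ip V v u = cnj z" unfolding z_def using ip_cnj[OF u v] .
  define P Q where "P = Re (ip V u u)" and "Q = Re (ip V v v)"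
  have PQ: "ip V u u = complex_of_real P" "ip V v v = complex_of_real Q" "0 \<le> P" "0 \<le> Q"
    using nn[OF u] nn[OF v] by (auto simp: P_def Q_def complex_eq_iff)
  have expand: "ip V (u \<oplus>\<^bsub>V\<^esub> c \<odot>\<^bsub>V\<^esub> v) (u \<oplus>\<^bsub>V\<^esub> c \<odot>\<^bsub>V\<^esub> v) =
      complex_of_real P + cnj c * z + c * cnj z + c * cnj c * complex_of_real Q" for c
    using u v sm[OF v, of c]
    by (simp add: ip_add_left ip_smult_left addr smr zc z_def[symmetric] PQ algebra_simps)
  have cs2: "(cmod z)\<^sup>2 \<le> P * Q"
  proof (cases "Q = 0")
    case True
    then have "v = \<zero>\<^bsub>V\<^esub>" using ip_definite[OF v] PQ by simp
    then have "z = ip V u (0 \<odot>\<^bsub>V\<^esub> v)"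
      using smult_l_null[OF v] by (simp add: z_def ring_of_type_algebra_def)
    then have "z = 0" using smr[OF u v, of 0] by simp
    then show ?thesis using PQ by simp
  next
    case False
    define c where "c = - z / complex_of_real Q"
    have "complex_of_real P + cnj c * z + c * cnj z + c * cnj c * complex_of_real Q
        = complex_of_real P - z * cnj z / complex_of_real Q"
      using False by (simp add: c_def field_simps)
    also have "\<dots> = complex_of_real (P - (cmod z)\<^sup>2 / Q)"
      by (simp add: complex_norm_square del: of_real_power)
    finally have "ip V (u \<oplus>\<^bsub>V\<^esub> c \<odot>\<^bsub>V\<^esub> v) (u \<oplus>\<^bsub>V\<^esub> c \<odot>\<^bsub>V\<^esub> v) =
        complex_of_real (P - (cmod z)\<^sup>2 / Q)"
      unfolding expand .
    then have "Re (ip V (u \<oplus>\<^bsub>V\<^esub> c \<odot>\<^bsub>V\<^esub> v) (u \<oplus>\<^bsub>V\<^esub> c \<odot>\<^bsub>V\<^esub> v)) = P - (cmod z)\<^sup>2 / Q"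
      by (simp only: Re_complex_of_real)
    then have "0 \<le> P - (cmod z)\<^sup>2 / Q"
      using nn(1)[of "u \<oplus>\<^bsub>V\<^esub> c \<odot>\<^bsub>V\<^esub> v"] u sm[OF v, of c] by simp
    then show ?thesis using False PQ(4) by (simp add: field_simps)
  qed
  have "Re z \<le> cmod z" by (rule complex_Re_le_cmod)
  also have "\<dots> \<le> sqrt (P * Q)" using cs2 by (rule real_le_rsqrt)
  finally have rz: "Re z \<le> sqrt P * sqrt Q" by (simp add: real_sqrt_mult)
  have "ip V (u \<oplus>\<^bsub>V\<^esub> v) (u \<oplus>\<^bsub>V\<^esub> v) = complex_of_real P + z + cnj z + complex_of_real Q"
    using u v by (simp add: ip_add_left addr zc z_def[symmetric] PQ)
  then have "Re (ip V (u \<oplus>\<^bsub>V\<^esub> v) (u \<oplus>\<^bsub>V\<^esub> v)) = P + 2 * Re z + Q" by simp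
  also have "\<dots> \<le> (sqrt P + sqrt Q)\<^sup>2"
    using rz PQ by (simp add: power2_sum)
  finally show ?thesis
    unfolding ip_norm_def P_def[symmetric] Q_def[symmetric]
    by (rule real_le_lsqrt[rotated]) (use PQ in auto)
qed

lemma (in complex_ip_space) Metric_space_ip_dist: "Metric_space (carrier V) (ip_dist V)"
proof
  have neg: "\<ominus>\<^bsub>V\<^esub> w = (-1) \<odot>\<^bsub>V\<^esub> w" if "w \<in> carrier V" for w
  proof -
    have w1: "(-1) \<odot>\<^bsub>V\<^esub> w \<in> carrier V"
      using that smult_closed by (simp add: ring_of_type_algebra_def)
    have "(-1) \<odot>\<^bsub>V\<^esub> w \<oplus>\<^bsub>V\<^esub> w = ((-1) + 1) \<odot>\<^bsub>V\<^esub> w"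
      using that smult_l_distr[of "-1" 1 w] smult_one[OF that]
      by (simp add: ring_of_type_algebra_def)
    also have "\<dots> = \<zero>\<^bsub>V\<^esub>"
      using smult_l_null[OF that] by (simp add: ring_of_type_algebra_def)
    finally show ?thesis using that w1 M.minus_equality by blast
  qed
  have ipneg: "ip V (\<ominus>\<^bsub>V\<^esub> w) (\<ominus>\<^bsub>V\<^esub> w) = ip V w w" if w: "w \<in> carrier V" for w
  proof -
    have c: "\<ominus>\<^bsub>V\<^esub> w \<in> carrier V" using w by simp
    have l: "ip V (\<ominus>\<^bsub>V\<^esub> w) x = - ip V w x" if "x \<in> carrier V" for x
      using ip_smult_left[OF w that, of "-1"] by (simp add: neg[OF w])
    have "ip V (\<ominus>\<^bsub>V\<^esub> w) (\<ominus>\<^bsub>V\<^esub> w) = - cnj (ip V (\<ominus>\<^bsub>V\<^esub> w) w)"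
      using l[OF c] ip_cnj[OF c w] by simp
    also have "\<dots> = cnj (ip V w w)" using l[OF w] by simp
    also have "\<dots> = ip V w w" using ip_cnj[OF w w] by simp
    finally show ?thesis .
  qed
  show "0 \<le> ip_dist V x y" for x y
  proof (cases "x \<in> carrier V \<and> y \<in> carrier V")
    case True
    then have "x \<ominus>\<^bsub>V\<^esub> y \<in> carrier V" by simp
    from ip_nonneg[OF this] show ?thesis
      by (auto simp: ip_dist_def ip_norm_def nonneg_Reals_def)
  qed (auto simp: ip_dist_def)
  show "ip_dist V x y = ip_dist V y x" for x y
  proof (cases "x \<in> carrier V \<and> y \<in> carrier V")
    case True
    then have "y \<ominus>\<^bsub>V\<^esub> x = \<ominus>\<^bsub>V\<^esub> (x \<ominus>\<^bsub>V\<^esub> y)"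
      by (simp add: a_minus_def M.minus_add M.a_comm)
    then show ?thesis using ipneg[of "x \<ominus>\<^bsub>V\<^esub> y"] True by (simp add: ip_dist_def ip_norm_def)
  qed (auto simp: ip_dist_def)
  show "ip_dist V x y = 0 \<longleftrightarrow> x = y" if x: "x \<in> carrier V" and y: "y \<in> carrier V" for x y
  proof
    assume 0: "ip_dist V x y = 0"
    have xy: "x \<ominus>\<^bsub>V\<^esub> y \<in> carrier V" using x y by simp
    have "ip V (x \<ominus>\<^bsub>V\<^esub> y) (x \<ominus>\<^bsub>V\<^esub> y) = 0"
      using 0 x y ip_nonneg[OF xy] by (auto simp: ip_dist_def ip_norm_def nonneg_Reals_def)
    from ip_definite[OF xy this] show "x = y"
      using x y M.minus_equality[of x "\<ominus>\<^bsub>V\<^esub> y"] by (simp add: a_minus_def)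
  next
    have z: "\<zero>\<^bsub>V\<^esub> \<in> carrier V" by simp
    assume "x = y"
    moreover have "ip V \<zero>\<^bsub>V\<^esub> \<zero>\<^bsub>V\<^esub> = 0" using ip_add_left[OF z z z] by simp
    ultimately show "ip_dist V x y = 0"
      using x by (simp add: ip_dist_def ip_norm_def a_minus_def M.r_neg)
  qed
  show "ip_dist V x z \<le> ip_dist V x y + ip_dist V y z"
    if x: "x \<in> carrier V" and y: "y \<in> carrier V" and z: "z \<in> carrier V" for x y z
  proof -
    have "x \<ominus>\<^bsub>V\<^esub> z = (x \<ominus>\<^bsub>V\<^esub> y) \<oplus>\<^bsub>V\<^esub> (y \<ominus>\<^bsub>V\<^esub> z)"
      using x y z by (simp add: a_minus_def M.a_assoc M.r_neg1)
    then show ?thesis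
      using ip_norm_triangle[of "x \<ominus>\<^bsub>V\<^esub> y" "y \<ominus>\<^bsub>V\<^esub> z"] x y z by (simp add: ip_dist_def)
  qed
qed

lemma star_algebra_cont_functions_subalgebra:
  fixes A :: "('x::topological_space \<Rightarrow> complex) set"
  assumes "star_subalgebra A cont_functions" and "(\<lambda>x. 1) \<in> A"
  shows "star_algebra (cont_functions\<lparr>carrier := A\<rparr>)"
proof -
  let ?B = "cont_functions\<lparr>carrier := A\<rparr>"
  have B: "carrier ?B = A" "monoid.mult ?B = (\<lambda>a b x. a x * b x)" "one ?B = (\<lambda>x. 1)"
    "ring.zero ?B = (\<lambda>x. 0)" "add ?B = (\<lambda>a b x. a x + b x)"
    "smult ?B = (\<lambda>c a x. c * a x)" "star ?B = (\<lambda>a x. cnj (a x))"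
    by (simp_all add: cont_functions_def)
  have cl: "(\<lambda>x. a x + b x) \<in> A" "(\<lambda>x. a x * b x) \<in> A" "(\<lambda>x. c * a x) \<in> A"
    "(\<lambda>x. cnj (a x)) \<in> A" "(\<lambda>x. 0) \<in> A" if "a \<in> A" "b \<in> A" for a b c
    using assms that by (auto simp: star_subalgebra_def cont_functions_def)
  have neg: "(\<lambda>x. - a x) \<in> A" if "a \<in> A" for a
    using cl(3)[OF that that, of "-1"] by simp
  have C: "carrier complex_ring = UNIV" "monoid.mult complex_ring = (*)" "one complex_ring = 1"
    "add complex_ring = (+)"
    by (simp_all add: ring_of_type_algebra_def)
  have ab: "abelian_group ?B"
  proof (rule abelian_groupI)
    show "\<exists>b\<in>carrier ?B. b \<oplus>\<^bsub>?B\<^esub> a = \<zero>\<^bsub>?B\<^esub>" if "a \<in> carrier ?B" for a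
      using that unfolding B by (intro bexI[of _ "\<lambda>x. - a x"]) (simp_all add: neg)
  qed (unfold B, use cl assms(2) in \<open>simp_all add: fun_eq_iff algebra_simps\<close>)
  have mon: "monoid ?B"
    by (rule monoidI; unfold B) (use cl assms(2) in \<open>simp_all add: fun_eq_iff algebra_simps\<close>)
  have ring: "Ring.ring ?B"
    by (rule ringI[OF ab mon]; unfold B) (simp_all add: fun_eq_iff algebra_simps)
  have cr: "cring complex_ring" ..
  have "Module.module complex_ring ?B"
    by (rule moduleI[OF cr ab]; unfold B C) (use cl in \<open>simp_all add: fun_eq_iff algebra_simps\<close>)
  moreover have "star_algebra_axioms ?B"
    by (rule star_algebra_axioms.intro; unfold B)
      (use cl in \<open>simp_all add: fun_eq_iff algebra_simps\<close>)
  ultimately show ?thesis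
    using ring by (simp add: star_algebra_def)
qed

lemma density_functional_positive:
  fixes A :: "('x::topological_space \<Rightarrow> complex) set"
  assumes A: "star_subalgebra A cont_functions"
    and int: "\<And>a. a \<in> A \<Longrightarrow> integrable \<mu> a"
    and h: "h \<in> L_infinity \<mu>" "AE x in \<mu>. 0 \<le> h x"
  shows "density_functional \<mu> h \<in> positive_functionals (cont_functions\<lparr>carrier := A\<rparr>)"
proof -
  have hm: "h \<in> borel_measurable \<mu>" using h by (simp add: L_infinity_def)
  obtain C where C: "AE x in \<mu>. \<bar>h x\<bar> \<le> C" using h by (auto simp: L_infinity_def)
  have inth: "integrable \<mu> (\<lambda>x. a x * complex_of_real (h x))" if "a \<in> A" for a
  proof (rule Bochner_Integration.integrable_bound)
    show "integrable \<mu> (\<lambda>x. complex_of_real C * a x)" using int[OF that] by simp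
    show "(\<lambda>x. a x * complex_of_real (h x)) \<in> borel_measurable \<mu>"
      using hm int[OF that] by measurable
    show "AE x in \<mu>. norm (a x * complex_of_real (h x)) \<le> norm (complex_of_real C * a x)"
      using C
    proof eventually_elim
      case (elim x)
      then have "\<bar>h x\<bar> \<le> \<bar>C\<bar>" by linarith
      then have "\<bar>h x\<bar> * norm (a x) \<le> \<bar>C\<bar> * norm (a x)"
        by (intro mult_right_mono) auto
      then show ?case by (simp add: norm_mult mult.commute)
    qed
  qed
  have pos: "density_functional \<mu> h (\<lambda>x. cnj (a x) * a x) \<in> \<real>\<^sub>\<ge>\<^sub>0" for a
  proof -
    have "density_functional \<mu> h (\<lambda>x. cnj (a x) * a x) =
        (\<integral>x. complex_of_real ((cmod (a x))\<^sup>2 * h x) \<partial>\<mu>)"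
      unfolding density_functional_def
      by (rule Bochner_Integration.integral_cong)
        (simp_all add: complex_norm_square mult_ac del: of_real_power)
    also have "\<dots> = complex_of_real (\<integral>x. (cmod (a x))\<^sup>2 * h x \<partial>\<mu>)"
      by (rule integral_complex_of_real)
    finally have eq: "density_functional \<mu> h (\<lambda>x. cnj (a x) * a x) =
        complex_of_real (\<integral>x. (cmod (a x))\<^sup>2 * h x \<partial>\<mu>)" .
    have "0 \<le> (\<integral>x. (cmod (a x))\<^sup>2 * h x \<partial>\<mu>)"
      using h(2) by (intro integral_nonneg_AE) (auto elim!: eventually_mono)
    then show ?thesis unfolding eq by simp
  qed
  have add: "density_functional \<mu> h (\<lambda>x. a x + b x) =
      density_functional \<mu> h a + density_functional \<mu> h b" if "a \<in> A" "b \<in> A" for a b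
    using inth[OF that(1)] inth[OF that(2)]
    by (simp add: density_functional_def distrib_right)
  have scale: "density_functional \<mu> h (\<lambda>x. c * a x) = c * density_functional \<mu> h a" for c a
    by (simp add: density_functional_def mult.assoc)
  show ?thesis
    using pos add scale by (auto simp: positive_functionals_def cont_functions_def)
qed

end

theory Submission
  imports Defs
begin

text \<open>
  Put \<open>p = \<eta>\<^sup>1\<^sup>/\<^sup>2\<close> and \<open>q = \<xi>\<^sup>1\<^sup>/\<^sup>2\<close>. In the representation of \<open>A\<close> by multiplication on the functions \<open>u\<close>
  with \<open>a u \<in> L\<^sup>2(\<mu>)\<close> for all \<open>a \<in> A\<close>, the vectors \<open>p\<close> and \<open>q\<close> represent the two functionals, which
  gives the lower bound. Conversely, vectors \<open>\<phi>\<close>, \<open>\<psi>\<close> of any representation induce a contraction \<open>T\<close>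
  between the completed GNS spaces. Compressing it to the multiplication domain gives a form \<open>B\<close>
  with \<open>B(p, q) = \<langle>\<phi>, \<psi>\<rangle>\<close> and \<open>\<bar>B(u, v)\<bar> \<le> \<parallel>u\<parallel> \<parallel>v\<parallel>\<close>, and self-adjointness yields
  \<open>B(a u, v) = B(u, a\<^sup>+ v)\<close>. Passing to resolvents of the real functions in \<open>A\<close>, then by
  Stone-Weierstrass and regularity of \<open>\<mu>\<close>, one gets \<open>B(b u, v) = B(u, b v)\<close> for every bounded
  measurable real \<open>b\<close>. Hence \<open>\<bar>B(p, q)\<bar> \<le> \<parallel>b p\<parallel> \<parallel>q / b\<parallel>\<close>, and \<open>b\<^sup>2 \<approx> q / p\<close> bounds this by \<open>\<integral> p q d\<mu>\<close>.
\<close>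

section \<open>Riesz representation\<close>

text \<open>The obstacle is that the operators are unbounded and the orbit \<open>A p\<close> is too
  small: its closure is a priori only a closed subspace of L^2, and a resolvent factor 1/(r^2 + 1)
  leads out of the orbit, where the intertwining relation says nothing. The domain
  \<open>mult_domain\<close> is stable under \<open>A\<close> and under bounded measurable
  multipliers. The adjoint of the isometry of the GNS space into L^2 maps it into the domain of the
  adjoint representation and turns multiplication by \<open>a\<close> into the adjoint action of
  \<open>a\<close>. Essential self-adjointness makes this adjoint representation hermitian on its
  whole domain, so the relation extends to exactly the vectors that the resolvents produce. It
  enters once for each functional: for the first, to see that \<open>T\<close> preserves the adjoint
  domains; for the second, to move \<open>a\<close> into the other argument. A bounded form that
  commutes with all bounded measurable multipliers is the integral of \<open>u\<close> times the
  conjugate of \<open>v\<close> against a function of modulus at most 1. The choice of the weight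
  \<open>b\<close> yields the resulting estimate at \<open>p\<close>, \<open>q\<close> without
  constructing that function.\<close>

context complex_ip_space
begin

lemma scale_closed [simp, intro]: "v \<in> carrier V \<Longrightarrow> c \<odot>\<^bsub>V\<^esub> v \<in> carrier V"
  using smult_closed by (simp add: ring_of_type_algebra_def)

lemma ip_add_right:
  "\<lbrakk>u \<in> carrier V; v \<in> carrier V; w \<in> carrier V\<rbrakk> \<Longrightarrow> ip V u (v \<oplus>\<^bsub>V\<^esub> w) = ip V u v + ip V u w"
  by (metis ip_cnj ip_add_left M.a_closed complex_cnj_add)

lemma ip_smult_right:
  "\<lbrakk>u \<in> carrier V; v \<in> carrier V\<rbrakk> \<Longrightarrow> ip V u (c \<odot>\<^bsub>V\<^esub> v) = cnj c * ip V u v"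
  by (metis ip_cnj ip_smult_left scale_closed complex_cnj_mult)

lemma scale_zero: "v \<in> carrier V \<Longrightarrow> 0 \<odot>\<^bsub>V\<^esub> v = \<zero>\<^bsub>V\<^esub>"
  using smult_l_null by (simp add: ring_of_type_algebra_def)

lemma minus_eq_scale:
  assumes "u \<in> carrier V" "v \<in> carrier V"
  shows "u \<ominus>\<^bsub>V\<^esub> v = u \<oplus>\<^bsub>V\<^esub> (-1) \<odot>\<^bsub>V\<^esub> v"
proof -
  have "(-1) \<odot>\<^bsub>V\<^esub> v \<oplus>\<^bsub>V\<^esub> v = ((-1) + 1) \<odot>\<^bsub>V\<^esub> v"
    using assms smult_l_distr[of "-1" 1 v] smult_one[of v]
    by (simp add: ring_of_type_algebra_def)
  also have "\<dots> = \<zero>\<^bsub>V\<^esub>"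
    using scale_zero[OF assms(2)] by simp
  finally have "\<ominus>\<^bsub>V\<^esub> v = (-1) \<odot>\<^bsub>V\<^esub> v"
    using assms M.minus_equality by blast
  then show ?thesis
    by (simp add: a_minus_def)
qed

lemma ip_norm_nonneg: "v \<in> carrier V \<Longrightarrow> 0 \<le> ip_norm V v"
  using ip_nonneg[of v] by (auto simp: ip_norm_def nonneg_Reals_def)

lemma ip_self: "v \<in> carrier V \<Longrightarrow> ip V v v = complex_of_real ((ip_norm V v)\<^sup>2)"
  using ip_nonneg[of v] by (auto simp: ip_norm_def nonneg_Reals_def complex_eq_iff)

lemma ip_norm_sq: "v \<in> carrier V \<Longrightarrow> (ip_norm V v)\<^sup>2 = Re (ip V v v)"
  using ip_self by simp

lemma ip_norm_sq_add_scale: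
  assumes "u \<in> carrier V" "v \<in> carrier V"
  shows "(ip_norm V (u \<oplus>\<^bsub>V\<^esub> c \<odot>\<^bsub>V\<^esub> v))\<^sup>2 =
    (ip_norm V u)\<^sup>2 + 2 * Re (cnj c * ip V u v) + (cmod c)\<^sup>2 * (ip_norm V v)\<^sup>2"
proof -
  have "ip V (u \<oplus>\<^bsub>V\<^esub> c \<odot>\<^bsub>V\<^esub> v) (u \<oplus>\<^bsub>V\<^esub> c \<odot>\<^bsub>V\<^esub> v) =
      ip V u u + (cnj c * ip V u v + cnj (cnj c * ip V u v)) + (c * cnj c) * ip V v v"
    using assms ip_cnj[OF assms]
    by (simp add: ip_add_left ip_add_right ip_smult_left ip_smult_right algebra_simps)
  moreover have "c * cnj c = of_real ((cmod c)\<^sup>2)"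
    by (simp add: complex_norm_square del: of_real_power)
  ultimately show ?thesis
    using assms by (simp add: ip_norm_sq del: of_real_power)
qed

lemma ip_dist_sq:
  assumes "u \<in> carrier V" "v \<in> carrier V"
  shows "(ip_dist V u v)\<^sup>2 = (ip_norm V u)\<^sup>2 - 2 * Re (ip V u v) + (ip_norm V v)\<^sup>2"
  using assms ip_norm_sq_add_scale[OF assms, of "-1"] by (simp add: ip_dist_def minus_eq_scale)

lemma cauchy_schwarz:
  assumes "u \<in> carrier V" "v \<in> carrier V"
  shows "cmod (ip V u v) \<le> ip_norm V u * ip_norm V v"
proof (cases "ip_norm V v = 0")
  case True
  then have "v = \<zero>\<^bsub>V\<^esub>"
    using ip_definite[OF assms(2)] ip_self[OF assms(2)] by simp
  then have "ip V u v = 0"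
    using ip_smult_right[OF assms, of 0] scale_zero[OF assms(2)] by simp
  then show ?thesis
    using True by simp
next
  case False
  let ?z = "ip V u v"
  let ?n = "(ip_norm V v)\<^sup>2"
  have n: "?n > 0"
    using False by simp
  have "0 \<le> (ip_norm V u)\<^sup>2 + 2 * Re (cnj (- ?z / of_real ?n) * ?z)
      + (cmod (- ?z / of_real ?n))\<^sup>2 * ?n"
    by (subst ip_norm_sq_add_scale[OF assms, symmetric]) simp
  also have "cnj (- ?z / of_real ?n) * ?z = of_real (- (cmod ?z)\<^sup>2 / ?n)"
    by (simp add: complex_norm_square mult.commute del: of_real_power)
  also have "(cmod (- ?z / of_real ?n))\<^sup>2 * ?n = (cmod ?z)\<^sup>2 / ?n"
    using n by (simp add: norm_divide power_divide power2_eq_square norm_mult)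
  finally have "(cmod ?z)\<^sup>2 \<le> (ip_norm V u * ip_norm V v)\<^sup>2"
    using n by (simp add: field_simps power_mult_distrib)
  then show ?thesis
    using assms by (meson ip_norm_nonneg mult_nonneg_nonneg power2_le_imp_le)
qed

lemma tendsto_ip_left:
  assumes v: "\<And>n. v n \<in> carrier V" and z: "z \<in> carrier V" and w: "w \<in> carrier V"
    and lim: "(\<lambda>n. ip_dist V (v n) z) \<longlonglongrightarrow> 0"
  shows "(\<lambda>n. ip V (v n) w) \<longlonglongrightarrow> ip V z w"
proof -
  have "cmod (ip V (v n) w - ip V z w) \<le> ip_dist V (v n) z * ip_norm V w" for n
  proof -
    have "ip V (v n) w - ip V z w = ip V (v n \<ominus>\<^bsub>V\<^esub> z) w"
      using v z w by (simp add: minus_eq_scale ip_add_left ip_smult_left)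
    then show ?thesis
      using cauchy_schwarz[of "v n \<ominus>\<^bsub>V\<^esub> z" w] v[of n] z w by (simp add: ip_dist_def)
  qed
  moreover have "(\<lambda>n. ip_dist V (v n) z * ip_norm V w) \<longlonglongrightarrow> 0"
    using lim by (rule tendsto_mult_left_zero)
  ultimately have "(\<lambda>n. ip V (v n) w - ip V z w) \<longlonglongrightarrow> 0"
    by - (rule Lim_null_comparison[where g = "\<lambda>n. ip_dist V (v n) z * ip_norm V w"], auto)
  then show ?thesis
    by (rule LIM_zero_cancel)
qed

text \<open>The functional is given by its graph \<open>G\<close>, which need not be closed: the representing vector
  is the limit of a minimizing sequence of \<open>\<parallel>v\<parallel>\<^sup>2 - 2 Re s\<close> over \<open>(v, s) \<in> G\<close>.\<close>

lemma riesz_representation: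
  assumes complete: "Metric_space.mcomplete (carrier V) (ip_dist V)"
    and G: "G \<noteq> {}" "\<And>v s. (v, s) \<in> G \<Longrightarrow> v \<in> carrier V"
    and add: "\<And>v s w t. (v, s) \<in> G \<Longrightarrow> (w, t) \<in> G \<Longrightarrow> (v \<oplus>\<^bsub>V\<^esub> w, s + t) \<in> G"
    and scale: "\<And>v s c. (v, s) \<in> G \<Longrightarrow> (c \<odot>\<^bsub>V\<^esub> v, c * s) \<in> G"
    and bound: "\<And>v s. (v, s) \<in> G \<Longrightarrow> cmod s \<le> C * ip_norm V v" "0 \<le> C"
  obtains z where "z \<in> carrier V" "\<And>v s. (v, s) \<in> G \<Longrightarrow> s = ip V v z" "ip_norm V z \<le> C"
proof -
  interpret M: Metric_space "carrier V" "ip_dist V"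
    by (rule Metric_space_ip_dist)
  define J where "J p = (ip_norm V (fst p))\<^sup>2 - 2 * Re (snd p)" for p
  \<comment> \<open>Completing the square: (norm v - C)^2 is nonnegative, and Re s is at most C
    times norm v.\<close>
  have J_lower: "- (C\<^sup>2) \<le> J p" if "p \<in> G" for p
  proof -
    have "Re (snd p) \<le> C * ip_norm V (fst p)"
      using bound(1)[of "fst p" "snd p"] that complex_Re_le_cmod[of "snd p"] by simp
    moreover have "0 \<le> (ip_norm V (fst p))\<^sup>2 - 2 * (C * ip_norm V (fst p)) + C\<^sup>2"
      using zero_le_power2[of "ip_norm V (fst p) - C"] by (simp add: power2_diff mult.commute)
    ultimately show ?thesis
      unfolding J_def by linarith
  qed
  define d where "d = Inf (J ` G)"
  have bdd: "bdd_below (J ` G)"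
    using J_lower by (auto intro!: bdd_belowI2)
  have d_le: "d \<le> J p" if "p \<in> G" for p
    unfolding d_def using that bdd by (simp add: cInf_lower)
  have "\<exists>p\<in>G. J p < d + 1 / real (Suc n)" for n
  proof -
    have "Inf (J ` G) < d + 1 / real (Suc n)"
      unfolding d_def by simp
    then show ?thesis
      using cInf_lessD[of "J ` G"] G(1) by blast
  qed
  then obtain p where p: "\<And>n. p n \<in> G" "\<And>n. J (p n) < d + 1 / real (Suc n)"
    by metis
  define v s where "v n = fst (p n)" and "s n = snd (p n)" for n
  have vs: "(v n, s n) \<in> G" for n
    using p(1) by (simp add: v_def s_def)
  then have v: "v n \<in> carrier V" for n
    using G(2) by blast
  have J_vs: "(ip_norm V (v n))\<^sup>2 - 2 * Re (s n) < d + 1 / real (Suc n)" for n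
    using p(2)[of n] by (simp add: J_def v_def s_def)
  \<comment> \<open>Parallelogram law: the squared distance is 2 J(m) + 2 J(n) - 4 J(midpoint), and
    the midpoint stays in \<open>G\<close>, so its value is at least \<open>d\<close>.\<close>
  have dist_bound: "(ip_dist V (v m) (v n))\<^sup>2 \<le> 2 / real (Suc m) + 2 / real (Suc n)" for m n
  proof -
    have "((1/2) \<odot>\<^bsub>V\<^esub> v m \<oplus>\<^bsub>V\<^esub> (1/2) \<odot>\<^bsub>V\<^esub> v n, (1/2) * s m + (1/2) * s n) \<in> G"
      by (intro add scale vs)
    from d_le[OF this]
    have "d \<le> (ip_norm V ((1/2) \<odot>\<^bsub>V\<^esub> v m \<oplus>\<^bsub>V\<^esub> (1/2) \<odot>\<^bsub>V\<^esub> v n))\<^sup>2 - Re (s m) - Re (s n)"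
      by (simp add: J_def)
    moreover have "(ip_norm V ((1/2) \<odot>\<^bsub>V\<^esub> v m \<oplus>\<^bsub>V\<^esub> (1/2) \<odot>\<^bsub>V\<^esub> v n))\<^sup>2 =
        (ip_norm V (v m))\<^sup>2 / 4 + Re (ip V (v m) (v n)) / 2 + (ip_norm V (v n))\<^sup>2 / 4"
      using v[of m] v[of n] ip_cnj[OF v[of m] v[of n]]
      by (simp add: ip_norm_sq ip_add_left ip_add_right ip_smult_left ip_smult_right field_simps)
    moreover have "2 / real (Suc k) = 2 * (1 / real (Suc k))" for k
      by simp
    ultimately show ?thesis
      using J_vs[of m] J_vs[of n] ip_dist_sq[OF v[of m] v[of n]] by linarith
  qed
  have "M.MCauchy v"
    unfolding M.MCauchy_def
  proof (intro conjI allI impI)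
    show "range v \<subseteq> carrier V"
      using v by blast
    fix e :: real assume "0 < e"
    then obtain N where N: "4 / e\<^sup>2 < real N"
      using reals_Archimedean2 by blast
    have "ip_dist V (v m) (v n) < e" if "N \<le> m" "N \<le> n" for m n
    proof -
      have "2 / real (Suc m) + 2 / real (Suc n) \<le> 2 / real (Suc N) + 2 / real (Suc N)"
        using that by (intro add_mono divide_left_mono) auto
      also have "\<dots> = 4 / real (Suc N)"
        by simp
      also have "\<dots> < e\<^sup>2"
        using N \<open>0 < e\<close> by (simp add: field_simps) (simp add: add_strict_increasing)
      finally have "(ip_dist V (v m) (v n))\<^sup>2 < e\<^sup>2"
        using dist_bound[of m n] by linarith
      then show ?thesis
        using \<open>0 < e\<close> by (meson less_imp_le power2_less_imp_less)
    qed
    then show "\<exists>N. \<forall>n n'. N \<le> n \<longrightarrow> N \<le> n' \<longrightarrow> ip_dist V (v n) (v n') < e"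
      by blast
  qed
  then obtain z where "limitin M.mtopology v z sequentially"
    using complete unfolding M.mcomplete_def by blast
  then have z: "z \<in> carrier V" and "\<forall>e>0. \<exists>N. \<forall>n\<ge>N. ip_dist V (v n) z < e"
    unfolding M.limit_metric_sequentially by blast+
  then have dist0: "(\<lambda>n. ip_dist V (v n) z) \<longlonglongrightarrow> 0"
    by (intro LIMSEQ_I) (use M.nonneg in auto)
  note ip_lim = tendsto_ip_left[OF v z _ dist0]
  have inv0: "(\<lambda>n. 1 / real (Suc n)) \<longlonglongrightarrow> 0"
    using LIMSEQ_inverse_real_of_nat by (simp add: inverse_eq_divide)
  have rep: "t = ip V w z" if wt: "(w, t) \<in> G" for w t
  proof -
    have w: "w \<in> carrier V"
      using wt G(2) by blast
    \<comment> \<open>First variation at the limit: in J(v_n + c w) - J(v_n) the values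
      \<open>s n\<close> cancel, and what remains involves \<open>v n\<close> only through inner
      products with \<open>w\<close>. These converge, whether or not \<open>z\<close> belongs to the
      domain of the functional.\<close>
    have key: "0 \<le> 2 * Re (c * (ip V w z - t)) + (cmod c)\<^sup>2 * (ip_norm V w)\<^sup>2" for c
    proof -
      have "0 \<le> 1 / real (Suc n) + 2 * Re (cnj c * ip V (v n) w)
          + (cmod c)\<^sup>2 * (ip_norm V w)\<^sup>2 - 2 * Re (c * t)" for n
        using d_le[OF add[OF vs[of n] scale[OF wt, of c]]] J_vs[of n]
        by (simp add: J_def ip_norm_sq_add_scale v w)
      moreover have "(\<lambda>n. 1 / real (Suc n) + 2 * Re (cnj c * ip V (v n) w)
          + (cmod c)\<^sup>2 * (ip_norm V w)\<^sup>2 - 2 * Re (c * t)) \<longlonglongrightarrow>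
          0 + 2 * Re (cnj c * ip V z w) + (cmod c)\<^sup>2 * (ip_norm V w)\<^sup>2 - 2 * Re (c * t)"
        by (intro tendsto_intros inv0 ip_lim w)
      ultimately have "0 \<le> 0 + 2 * Re (cnj c * ip V z w) + (cmod c)\<^sup>2 * (ip_norm V w)\<^sup>2
          - 2 * Re (c * t)"
        by (intro LIMSEQ_le_const) auto
      moreover have "Re (cnj c * ip V z w) = Re (c * ip V w z)"
        using ip_cnj[OF z w] by simp
      ultimately show ?thesis
        by (simp add: algebra_simps)
    qed
    define y N where "y = ip V w z - t" and "N = (ip_norm V w)\<^sup>2"
    \<comment> \<open>The step size makes x * N at most 1. With c = -x * cnj y the quadratic term is
      then at most half of the linear gain, which forces y = 0. Adding 1 to N covers the case w =
      0.\<close>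
    define x where "x = 1 / (N + 1)"
    have N: "0 \<le> N" "0 < x" "x * N \<le> 1"
      by (auto simp: N_def x_def field_simps add_pos_nonneg add_nonneg_pos)
    have "0 \<le> 2 * Re ((- of_real x * cnj y) * y) + (cmod (- of_real x * cnj y))\<^sup>2 * N"
      using key unfolding y_def N_def .
    also have "(- of_real x * cnj y) * y = of_real (- x * (cmod y)\<^sup>2)"
      by (simp add: complex_norm_square mult.commute del: of_real_power)
    also have "(cmod (- of_real x * cnj y))\<^sup>2 * N = x * (cmod y)\<^sup>2 * (x * N)"
      by (simp add: norm_mult power_mult_distrib power2_eq_square[of x])
    also have "\<dots> \<le> x * (cmod y)\<^sup>2 * 1"
      using N by (intro mult_left_mono) auto
    finally have "x * (cmod y)\<^sup>2 \<le> 0"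
      by simp
    then have "(cmod y)\<^sup>2 \<le> 0"
      using N by (simp add: mult_le_0_iff)
    then show ?thesis
      by (simp add: y_def)
  qed
  \<comment> \<open>The bound on \<open>G\<close> cannot be applied to \<open>z\<close> itself. It
    is passed through the limit: Re (ip v_n z) = Re s_n is at most C times norm v_n, and both sides
    converge.\<close>
  have norms: "(\<lambda>n. (ip_norm V (v n))\<^sup>2) \<longlonglongrightarrow> (ip_norm V z)\<^sup>2"
  proof -
    have "(\<lambda>n. (ip_dist V (v n) z)\<^sup>2 + 2 * Re (ip V (v n) z) - (ip_norm V z)\<^sup>2) \<longlonglongrightarrow>
        0\<^sup>2 + 2 * Re (ip V z z) - (ip_norm V z)\<^sup>2"
      by (intro tendsto_intros dist0 ip_lim z)
    then show ?thesis
      using z v by (simp add: ip_dist_sq ip_norm_sq)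
  qed
  have "(\<lambda>n. sqrt ((ip_norm V (v n))\<^sup>2)) \<longlonglongrightarrow> sqrt ((ip_norm V z)\<^sup>2)"
    by (intro tendsto_intros norms)
  then have "(\<lambda>n. C * ip_norm V (v n)) \<longlonglongrightarrow> C * ip_norm V z"
    using v z by (intro tendsto_intros) (simp add: ip_norm_nonneg)
  moreover have "(\<lambda>n. Re (ip V (v n) z)) \<longlonglongrightarrow> Re (ip V z z)"
    by (intro tendsto_intros ip_lim z)
  moreover have "Re (ip V (v n) z) \<le> C * ip_norm V (v n)" for n
    using bound(1)[OF vs[of n]] rep[OF vs[of n]] complex_Re_le_cmod[of "s n"] by simp
  ultimately have "(ip_norm V z)\<^sup>2 \<le> C * ip_norm V z"
    unfolding ip_norm_sq[OF z] by (intro LIMSEQ_le) auto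
  then have norm_z: "ip_norm V z \<le> C"
    using ip_norm_nonneg[OF z] \<open>0 \<le> C\<close> by (cases "ip_norm V z = 0") (auto simp: power2_eq_square)
  show thesis
  proof (rule that[OF z])
    show "t = ip V w z" if "(w, t) \<in> G" for w t
      using rep that .
    show "ip_norm V z \<le> C"
      using norm_z .
  qed
qed

text \<open>The difference is orthogonal to \<open>S\<close>, so by Pythagoras no element of
  \<open>S\<close> is closer to it than its own norm; density makes that norm 0.\<close>

lemma eq_by_dense_ip:
  assumes dense: "Metric_space.mtopology (carrier V) (ip_dist V) closure_of S = carrier V"
    and S: "S \<subseteq> carrier V"
    and x: "x \<in> carrier V" and y: "y \<in> carrier V"
    and eq: "\<And>s. s \<in> S \<Longrightarrow> ip V s x = ip V s y"
  shows "x = y"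
proof -
  interpret M: Metric_space "carrier V" "ip_dist V"
    by (rule Metric_space_ip_dist)
  let ?w = "x \<ominus>\<^bsub>V\<^esub> y"
  have w: "?w \<in> carrier V"
    using x y by simp
  have orth: "ip V ?w s = 0" if "s \<in> S" for s
    using that S x y eq[OF that] ip_cnj[of s x] ip_cnj[of s y]
    by (simp add: minus_eq_scale ip_add_left ip_smult_left subset_iff)
  have "ip_norm V ?w \<le> 0 + r" if r: "0 < r" for r
  proof -
    have "?w \<in> M.mtopology closure_of S"
      unfolding dense by (rule w)
    then obtain s where s: "s \<in> S" "ip_dist V ?w s < r"
      using r unfolding M.metric_closure_of M.in_mball by blast
    have "(ip_norm V ?w)\<^sup>2 \<le> (ip_dist V ?w s)\<^sup>2"
      using ip_dist_sq[OF w, of s] orth[OF s(1)] s(1) S by auto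
    then have "ip_norm V ?w \<le> ip_dist V ?w s"
      using M.nonneg by (rule power2_le_imp_le)
    then show ?thesis
      using s(2) by simp
  qed
  then have "ip_norm V ?w \<le> 0"
    by (rule field_le_epsilon)
  then have "ip V ?w ?w = 0"
    using ip_self[OF w] ip_norm_nonneg[OF w] by simp
  then have "?w = \<zero>\<^bsub>V\<^esub>"
    by (rule ip_definite[OF w])
  then show ?thesis
    using x y M.minus_equality[of x "\<ominus>\<^bsub>V\<^esub> y"] by (simp add: a_minus_def)
qed

end

section \<open>Self-adjoint GNS representations\<close>

text \<open>With \<open>e a = \<pi>(a)\<phi>\<close>, an orbit records \<open>h\<close> in the domain of \<open>\<pi>\<^sup>*\<close> together with
  \<open>k a = \<pi>\<^sup>*(a) h\<close>.\<close>

definition adjoint_orbit :: "('a, 'm) star_algebra_scheme \<Rightarrow> ('v, 'n) ip_space_scheme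
    \<Rightarrow> ('a \<Rightarrow> 'v) \<Rightarrow> 'v \<Rightarrow> ('a \<Rightarrow> 'v) \<Rightarrow> bool" where
  "adjoint_orbit A H e h k \<longleftrightarrow> h \<in> carrier H \<and>
     (\<forall>a\<in>carrier A. k a \<in> carrier H \<and>
       (\<forall>b\<in>carrier A. ip H (e (star A a \<otimes>\<^bsub>A\<^esub> b)) h = ip H (e b) (k a)))"

text \<open>This keeps only the completed GNS space and the map \<open>e\<close> from
  \<open>A\<close> onto the dense orbit of the cyclic vector. The assumption
  \<open>symmetric\<close> is the form in which essential self-adjointness is used: the adjoint
  representation is again hermitian.\<close>

locale self_adjoint_gns = A: star_algebra A + H: complex_ip_space H
  for A :: "('a, 'm) star_algebra_scheme" and H :: "('v, 'n) ip_space_scheme"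
    and f :: "'a \<Rightarrow> complex" and e :: "'a \<Rightarrow> 'v" +
  assumes complete: "Metric_space.mcomplete (carrier H) (ip_dist H)"
    and e_closed: "a \<in> carrier A \<Longrightarrow> e a \<in> carrier H"
    and e_add: "\<lbrakk>a \<in> carrier A; b \<in> carrier A\<rbrakk> \<Longrightarrow> e (a \<oplus>\<^bsub>A\<^esub> b) = e a \<oplus>\<^bsub>H\<^esub> e b"
    and e_smult: "a \<in> carrier A \<Longrightarrow> e (c \<odot>\<^bsub>A\<^esub> a) = c \<odot>\<^bsub>H\<^esub> e a"
    and ip_e: "\<lbrakk>a \<in> carrier A; b \<in> carrier A\<rbrakk> \<Longrightarrow> ip H (e a) (e b) = f (star A b \<otimes>\<^bsub>A\<^esub> a)"
    and dense: "Metric_space.mtopology (carrier H) (ip_dist H) closure_of (e ` carrier A) = carrier H"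
    and symmetric: "\<lbrakk>adjoint_orbit A H e h k; adjoint_orbit A H e h' k'; a \<in> carrier A\<rbrakk>
      \<Longrightarrow> ip H (k (star A a)) h' = ip H h (k' a)"
begin

lemma eqI:
  assumes "x \<in> carrier H" "y \<in> carrier H"
    and "\<And>a. a \<in> carrier A \<Longrightarrow> ip H (e a) x = ip H (e a) y"
  shows "x = y"
  using H.eq_by_dense_ip[OF dense _ assms(1,2)] assms(3) e_closed by auto

lemma smult_A_closed [simp]: "a \<in> carrier A \<Longrightarrow> c \<odot>\<^bsub>A\<^esub> a \<in> carrier A"
  using A.smult_closed by (simp add: ring_of_type_algebra_def)

text \<open>The functional is given on \<open>A\<close>, not on the vectors \<open>e a\<close>.
  Passing to the graph of pairs (e a, l a) avoids a separate proof that \<open>l\<close> factors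
  through \<open>e\<close>; the bound takes care of it.\<close>

lemma riesz:
  assumes closed: "\<And>a b. a \<in> carrier A \<Longrightarrow> b \<in> carrier A \<Longrightarrow> l (a \<oplus>\<^bsub>A\<^esub> b) = l a + l b"
    and smult: "\<And>a c. a \<in> carrier A \<Longrightarrow> l (c \<odot>\<^bsub>A\<^esub> a) = c * l a"
    and bound: "\<And>a. a \<in> carrier A \<Longrightarrow> cmod (l a) \<le> C * ip_norm H (e a)" "0 \<le> C"
  shows "\<exists>z. z \<in> carrier H \<and> (\<forall>a\<in>carrier A. l a = ip H (e a) z) \<and> ip_norm H z \<le> C"
proof (rule H.riesz_representation[OF complete, of "(\<lambda>a. (e a, l a)) ` carrier A" C])
  show "(\<lambda>a. (e a, l a)) ` carrier A \<noteq> {}"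
    using A.zero_closed by blast
  show "v \<in> carrier H" if "(v, s) \<in> (\<lambda>a. (e a, l a)) ` carrier A" for v s
    using that e_closed by auto
  show "(v \<oplus>\<^bsub>H\<^esub> w, s + t) \<in> (\<lambda>a. (e a, l a)) ` carrier A"
    if vs: "(v, s) \<in> (\<lambda>a. (e a, l a)) ` carrier A" and wt: "(w, t) \<in> (\<lambda>a. (e a, l a)) ` carrier A"
    for v s w t
  proof -
    obtain a b where "a \<in> carrier A" "b \<in> carrier A" "v = e a" "s = l a" "w = e b" "t = l b"
      using vs wt by auto
    then show ?thesis
      using e_add closed by (intro image_eqI[of _ _ "a \<oplus>\<^bsub>A\<^esub> b"]) auto
  qed
  show "(c \<odot>\<^bsub>H\<^esub> v, c * s) \<in> (\<lambda>a. (e a, l a)) ` carrier A"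
    if vs: "(v, s) \<in> (\<lambda>a. (e a, l a)) ` carrier A" for v s c
  proof -
    obtain a where "a \<in> carrier A" "v = e a" "s = l a"
      using vs by auto
    then show ?thesis
      using e_smult smult by (intro image_eqI[of _ _ "c \<odot>\<^bsub>A\<^esub> a"]) auto
  qed
  show "cmod s \<le> C * ip_norm H v" if "(v, s) \<in> (\<lambda>a. (e a, l a)) ` carrier A" for v s
    using that bound(1) by auto
qed (use bound in auto)

end

text \<open>An orbit (h, k) says that h lies in the domain of the adjoint representation and that k
  a is its action. A second such vector h' also lies in the domain of the biclosure, since the
  domains agree; there \<open>a\<close> moves across by definition of the biclosure, and equality of
  the actions turns the result back into \<open>k' a\<close>.\<close>

lemma self_adjoint_gnsI:
  fixes A :: "('a, 'm) star_algebra_scheme" and V H :: "('v, 'n) ip_space_scheme"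
  assumes gns: "gns_rep A f V \<pi> \<phi>" and compl: "hilbert_completion V H"
    and ess: "essentially_self_adjoint A V H \<pi>"
  shows "self_adjoint_gns A H f (\<lambda>a. \<pi> a \<phi>)"
proof -
  interpret R: star_rep A V \<pi>
    using gns by (simp add: gns_rep_def)
  interpret H: complex_ip_space H
    using compl by (simp add: hilbert_completion_def hilbert_space_def)
  define e where "e a = \<pi> a \<phi>" for a
  have \<phi>: "\<phi> \<in> carrier V" and V: "carrier V = e ` carrier A"
    and f: "\<And>a. a \<in> carrier A \<Longrightarrow> f a = ip V (\<pi> a \<phi>) \<phi>"
    using gns by (auto simp: gns_rep_def e_def)
  have VH: "carrier V \<subseteq> carrier H"
    and add: "\<And>v w. v \<in> carrier V \<Longrightarrow> w \<in> carrier V \<Longrightarrow> v \<oplus>\<^bsub>V\<^esub> w = v \<oplus>\<^bsub>H\<^esub> w"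
    and ip: "\<And>v w. v \<in> carrier V \<Longrightarrow> w \<in> carrier V \<Longrightarrow> ip V v w = ip H v w"
    and smult: "\<And>c v. v \<in> carrier V \<Longrightarrow> c \<odot>\<^bsub>V\<^esub> v = c \<odot>\<^bsub>H\<^esub> v"
    and dense: "Metric_space.mtopology (carrier H) (ip_dist H) closure_of (carrier V) = carrier H"
    using compl by (auto simp: hilbert_completion_def)
  have e_V: "e a \<in> carrier V" if "a \<in> carrier A" for a
    using that V by blast
  have unique: "x = y" if "x \<in> carrier H" "y \<in> carrier H"
    "\<And>v. v \<in> carrier V \<Longrightarrow> ip H v x = ip H v y" for x y
    using H.eq_by_dense_ip[OF dense VH] that by blast
  have e_mult: "e (a \<otimes>\<^bsub>A\<^esub> b) = \<pi> a (e b)" if "a \<in> carrier A" "b \<in> carrier A" for a b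
    using that \<phi> by (simp add: e_def R.rep_mult)
  let ?D1 = "adjoint_rep_dom A H (carrier V) \<pi>"
  let ?\<pi>1 = "adjoint_rep A H (carrier V) \<pi>"
  let ?D2 = "adjoint_rep_dom A H ?D1 ?\<pi>1"
  let ?\<pi>2 = "adjoint_rep A H ?D1 ?\<pi>1"
  have ess': "?D1 = ?D2" "\<And>a x. a \<in> carrier A \<Longrightarrow> x \<in> ?D1 \<Longrightarrow> ?\<pi>1 a x = ?\<pi>2 a x"
    using ess by (auto simp: essentially_self_adjoint_def Let_def)
  have orbit: "h \<in> ?D1 \<and> (\<forall>a\<in>carrier A. ?\<pi>1 a h = k a)" if "adjoint_orbit A H e h k" for h k
  proof -
    have h: "h \<in> carrier H" and k: "\<And>a. a \<in> carrier A \<Longrightarrow> k a \<in> carrier H"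
      and hk: "\<And>a v. a \<in> carrier A \<Longrightarrow> v \<in> carrier V \<Longrightarrow> ip H (\<pi> (star A a) v) h = ip H v (k a)"
      using that V by (auto simp: adjoint_orbit_def e_mult R.A.star_closed)
    have "h \<in> adjoint_dom H (carrier V) (\<pi> a)" if a: "a \<in> carrier A" for a
      unfolding adjoint_dom_def
      using h k[OF R.A.star_closed[OF a]] hk[OF R.A.star_closed[OF a]] R.A.star_star[OF a] by auto
    moreover have "?\<pi>1 a h = k a" if "a \<in> carrier A" for a
      unfolding adjoint_rep_def adjoint_op_def
    proof (rule the_equality)
      show "k a \<in> carrier H \<and> (\<forall>v\<in>carrier V. ip H (\<pi> (star A a) v) h = ip H v (k a))"
        using k[OF that] hk[OF that] by blast
      show "x = k a"
        if "x \<in> carrier H \<and> (\<forall>v\<in>carrier V. ip H (\<pi> (star A a) v) h = ip H v x)" for x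
        using that k[OF \<open>a \<in> carrier A\<close>] hk[OF \<open>a \<in> carrier A\<close>] by (intro unique) auto
    qed
    ultimately show ?thesis
      by (auto simp: adjoint_rep_dom_def)
  qed
  \<comment> \<open>A hermitian representation is contained in its adjoint. Hence \<open>?D1\<close>
    is dense, which makes the vector in the definition of the second adjoint unique.\<close>
  have V_D1: "carrier V \<subseteq> ?D1"
  proof
    fix v assume "v \<in> carrier V"
    then obtain b where b: "b \<in> carrier A" "v = e b"
      using V by blast
    have "adjoint_orbit A H e v (\<lambda>a. \<pi> a v)"
      unfolding adjoint_orbit_def
    proof (intro conjI ballI)
      show "v \<in> carrier H"
        using \<open>v \<in> carrier V\<close> VH by blast
      fix a assume a: "a \<in> carrier A"
      show "\<pi> a v \<in> carrier H"
        using R.rep_closed[OF a \<open>v \<in> carrier V\<close>] VH by blast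
      fix c assume c: "c \<in> carrier A"
      show "ip H (e (star A a \<otimes>\<^bsub>A\<^esub> c)) v = ip H (e c) (\<pi> a v)"
        using R.rep_star[OF R.A.star_closed[OF a] e_V[OF c] \<open>v \<in> carrier V\<close>]
        by (simp add: e_mult R.A.star_closed R.A.star_star a c e_V \<open>v \<in> carrier V\<close> R.rep_closed ip[symmetric])
    qed
    then show "v \<in> ?D1"
      using orbit by blast
  qed
  show ?thesis
    unfolding e_def[symmetric]
  proof unfold_locales
    show "Metric_space.mcomplete (carrier H) (ip_dist H)"
      using compl by (simp add: hilbert_completion_def hilbert_space_def)
    show "e a \<in> carrier H" if "a \<in> carrier A" for a
      using e_V[OF that] VH by blast
    show "e (a \<oplus>\<^bsub>A\<^esub> b) = e a \<oplus>\<^bsub>H\<^esub> e b" if "a \<in> carrier A" "b \<in> carrier A" for a b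
      using that \<phi> add[OF e_V e_V] by (simp add: e_def R.rep_add)
    show "e (c \<odot>\<^bsub>A\<^esub> a) = c \<odot>\<^bsub>H\<^esub> e a" if "a \<in> carrier A" for a c
      using that \<phi> smult[OF e_V] by (simp add: e_def R.rep_smult)
    show "ip H (e a) (e b) = f (star A b \<otimes>\<^bsub>A\<^esub> a)" if "a \<in> carrier A" "b \<in> carrier A" for a b
      using that \<phi> R.rep_star[of "star A b" "e a" \<phi>]
      by (simp add: f ip[symmetric] e_V R.A.star_closed R.A.star_star R.rep_mult)
        (simp add: e_def)
    show "Metric_space.mtopology (carrier H) (ip_dist H) closure_of (e ` carrier A) = carrier H"
      using dense V by simp
    show "ip H (k (star A a)) h' = ip H h (k' a)"
      if hk: "adjoint_orbit A H e h k" and hk': "adjoint_orbit A H e h' k'" and a: "a \<in> carrier A"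
      for h k h' k' a
    proof -
      let ?P = "\<lambda>z. z \<in> carrier H \<and> (\<forall>x\<in>?D1. ip H (?\<pi>1 (star A a) x) h' = ip H x z)"
      have "h' \<in> ?D2"
        using orbit[OF hk'] ess' by blast
      then obtain z where z: "?P z"
        using R.A.star_closed[OF a] by (auto simp: adjoint_rep_dom_def[of A H ?D1] adjoint_dom_def)
      have "?P (THE z. ?P z)"
        using z by (rule theI) (use z V_D1 in \<open>intro unique; auto\<close>)
      moreover have "(THE z. ?P z) = ?\<pi>2 a h'"
        by (simp add: adjoint_rep_def[of A H ?D1] adjoint_op_def[of H ?D1])
      ultimately have "ip H (?\<pi>1 (star A a) h) h' = ip H h (?\<pi>2 a h')"
        using orbit[OF hk] by simp
      then show ?thesis
        using orbit[OF hk] orbit[OF hk'] ess'(2) a R.A.star_closed[OF a] by auto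
    qed
  qed
qed

section \<open>Comparison of the GNS spaces with an arbitrary representation\<close>

lemma (in star_rep) ip_representing_vector:
  assumes "\<phi> \<in> representing_vectors A V \<pi> f" and a: "a \<in> carrier A" and b: "b \<in> carrier A"
  shows "ip V (\<pi> a \<phi>) (\<pi> b \<phi>) = f (star A b \<otimes>\<^bsub>A\<^esub> a)"
proof -
  have \<phi>: "\<phi> \<in> carrier V" and f: "\<And>a. a \<in> carrier A \<Longrightarrow> f a = ip V (\<pi> a \<phi>) \<phi>"
    using assms by (auto simp: representing_vectors_def)
  show ?thesis
    using rep_star[of "star A b" "\<pi> a \<phi>" \<phi>] a b \<phi>
    by (simp add: f A.star_closed A.star_star rep_mult rep_closed)
qed

text \<open>\<open>T\<close> is the transpose of the form \<open>(\<pi>(a)\<phi>, \<pi>(b)\<psi>)\<close>; the auxiliary \<open>S b\<close> is \<open>T\<^sup>* (d b)\<close>.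
  \<open>T\<close> intertwines the adjoint representations because \<open>H\<close> is self-adjoint, and passing from the
  left to the right factor uses that \<open>K\<close> is self-adjoint.\<close>

lemma intertwiner:
  fixes V :: "('u, 'k) ip_space_scheme" and H :: "('v, 'n) ip_space_scheme"
    and K :: "('w, 'l) ip_space_scheme"
  assumes "self_adjoint_gns A H f e" and "self_adjoint_gns A K g d" and "star_rep A V \<pi>"
    and \<phi>: "\<phi> \<in> representing_vectors A V \<pi> f" and \<psi>: "\<psi> \<in> representing_vectors A V \<pi> g"
  obtains T where "\<And>h. h \<in> carrier H \<Longrightarrow> T h \<in> carrier K"
    and "\<And>h h'. \<lbrakk>h \<in> carrier H; h' \<in> carrier H\<rbrakk> \<Longrightarrow> T (h \<oplus>\<^bsub>H\<^esub> h') = T h \<oplus>\<^bsub>K\<^esub> T h'"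
    and "\<And>h c. h \<in> carrier H \<Longrightarrow> T (c \<odot>\<^bsub>H\<^esub> h) = c \<odot>\<^bsub>K\<^esub> T h"
    and "\<And>h. h \<in> carrier H \<Longrightarrow> ip_norm K (T h) \<le> ip_norm H h"
    and "\<And>a b. \<lbrakk>a \<in> carrier A; b \<in> carrier A\<rbrakk> \<Longrightarrow> ip K (T (e a)) (d b) = ip V (\<pi> a \<phi>) (\<pi> b \<psi>)"
    and "\<And>h k h' k' a. \<lbrakk>adjoint_orbit A H e h k; adjoint_orbit A K d h' k'; a \<in> carrier A\<rbrakk>
      \<Longrightarrow> ip K (T (k (star A a))) h' = ip K (T h) (k' a)"
proof -
  interpret H: self_adjoint_gns A H f e by fact
  interpret K: self_adjoint_gns A K g d by fact
  interpret R: star_rep A V \<pi> by fact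
  note star_closed = H.A.star_closed
  have \<phi>V: "\<phi> \<in> carrier V" and \<psi>V: "\<psi> \<in> carrier V"
    using \<phi> \<psi> by (auto simp: representing_vectors_def)
  have norm_\<phi>: "ip_norm V (\<pi> a \<phi>) = ip_norm H (e a)" if "a \<in> carrier A" for a
    using that R.ip_representing_vector[OF \<phi>] H.ip_e by (simp add: ip_norm_def)
  have norm_\<psi>: "ip_norm V (\<pi> a \<psi>) = ip_norm K (d a)" if "a \<in> carrier A" for a
    using that R.ip_representing_vector[OF \<psi>] K.ip_e by (simp add: ip_norm_def)
  have "\<exists>z. z \<in> carrier H \<and> (\<forall>a\<in>carrier A. ip V (\<pi> a \<phi>) (\<pi> b \<psi>) = ip H (e a) z) \<and>
      ip_norm H z \<le> ip_norm K (d b)" if b: "b \<in> carrier A" for b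
  proof (rule H.riesz)
    show "cmod (ip V (\<pi> a \<phi>) (\<pi> b \<psi>)) \<le> ip_norm K (d b) * ip_norm H (e a)" if "a \<in> carrier A" for a
      using R.V.cauchy_schwarz[of "\<pi> a \<phi>" "\<pi> b \<psi>"] that b \<phi>V \<psi>V
      by (simp add: R.rep_closed norm_\<phi> norm_\<psi> mult.commute)
  qed (use b \<phi>V \<psi>V in \<open>simp_all add: R.rep_add R.rep_smult R.rep_closed R.V.ip_add_left R.V.ip_smult_left
        K.e_closed K.H.ip_norm_nonneg\<close>)
  then obtain S where S_closed: "\<And>b. b \<in> carrier A \<Longrightarrow> S b \<in> carrier H"
    and S: "\<And>a b. a \<in> carrier A \<Longrightarrow> b \<in> carrier A \<Longrightarrow> ip H (e a) (S b) = ip V (\<pi> a \<phi>) (\<pi> b \<psi>)"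
    and S_norm: "\<And>b. b \<in> carrier A \<Longrightarrow> ip_norm H (S b) \<le> ip_norm K (d b)"
    by metis
  have S_add: "S (a \<oplus>\<^bsub>A\<^esub> b) = S a \<oplus>\<^bsub>H\<^esub> S b" if "a \<in> carrier A" "b \<in> carrier A" for a b
    by (rule H.eqI) (use that \<phi>V \<psi>V in \<open>simp_all add: S_closed S H.e_closed H.H.ip_add_right
        R.rep_add R.rep_closed R.V.ip_add_right\<close>)
  have S_smult: "S (c \<odot>\<^bsub>A\<^esub> a) = c \<odot>\<^bsub>H\<^esub> S a" if "a \<in> carrier A" for a c
    by (rule H.eqI) (use that \<phi>V \<psi>V in \<open>simp_all add: S_closed S H.e_closed H.H.ip_smult_right
        R.rep_smult R.rep_closed R.V.ip_smult_right\<close>)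
  have "\<exists>z. z \<in> carrier K \<and> (\<forall>b\<in>carrier A. ip H (S b) h = ip K (d b) z) \<and>
      ip_norm K z \<le> ip_norm H h" if h: "h \<in> carrier H" for h
  proof (rule K.riesz)
    show "cmod (ip H (S a) h) \<le> ip_norm H h * ip_norm K (d a)" if "a \<in> carrier A" for a
    proof -
      have "cmod (ip H (S a) h) \<le> ip_norm H (S a) * ip_norm H h"
        using that h by (simp add: H.H.cauchy_schwarz S_closed)
      also have "\<dots> \<le> ip_norm K (d a) * ip_norm H h"
        using that h by (simp add: S_norm mult_right_mono H.H.ip_norm_nonneg)
      finally show ?thesis
        by (simp add: mult.commute)
    qed
  qed (use h in \<open>simp_all add: S_add S_smult S_closed H.H.ip_add_left H.H.ip_smult_left H.H.ip_norm_nonneg\<close>)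
  then obtain T where T_closed: "\<And>h. h \<in> carrier H \<Longrightarrow> T h \<in> carrier K"
    and T: "\<And>b h. b \<in> carrier A \<Longrightarrow> h \<in> carrier H \<Longrightarrow> ip K (d b) (T h) = ip H (S b) h"
    and T_norm: "\<And>h. h \<in> carrier H \<Longrightarrow> ip_norm K (T h) \<le> ip_norm H h"
    by metis
  show thesis
  proof (rule that)
    show "T (h \<oplus>\<^bsub>H\<^esub> h') = T h \<oplus>\<^bsub>K\<^esub> T h'" if "h \<in> carrier H" "h' \<in> carrier H" for h h'
      by (rule K.eqI) (use that in \<open>simp_all add: T_closed T S_closed K.e_closed H.H.ip_add_right K.H.ip_add_right\<close>)
    show "T (c \<odot>\<^bsub>H\<^esub> h) = c \<odot>\<^bsub>K\<^esub> T h" if "h \<in> carrier H" for h c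
      by (rule K.eqI) (use that in \<open>simp_all add: T_closed T S_closed K.e_closed H.H.ip_smult_right K.H.ip_smult_right\<close>)
    show "ip K (T (e a)) (d b) = ip V (\<pi> a \<phi>) (\<pi> b \<psi>)" if ab: "a \<in> carrier A" "b \<in> carrier A" for a b
    proof -
      have "ip K (T (e a)) (d b) = cnj (ip H (S b) (e a))"
        using K.H.ip_cnj[of "d b" "T (e a)"] ab by (simp add: T T_closed H.e_closed K.e_closed)
      also have "\<dots> = ip H (e a) (S b)"
        using H.H.ip_cnj[of "S b" "e a"] ab by (simp add: S_closed H.e_closed)
      finally show ?thesis
        using S ab by simp
    qed
    show "ip K (T (k (star A a))) h' = ip K (T h) (k' a)"
      if hk: "adjoint_orbit A H e h k" and hk': "adjoint_orbit A K d h' k'" and a: "a \<in> carrier A"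
      for h k h' k' a
    proof -
      \<comment> \<open>Moving \<open>a\<close> across the inner product of \<open>V\<close> shows
        that the adjoint representation sends \<open>S b\<close> to \<open>S\<close> of the product
        of \<open>a\<close> and \<open>b\<close>. Pairing this orbit with that of \<open>h\<close>
        by \<open>H.symmetric\<close> then places \<open>T h\<close> in the adjoint domain over
        \<open>K\<close>.\<close>
      have orbit_S: "adjoint_orbit A H e (S b) (\<lambda>a. S (a \<otimes>\<^bsub>A\<^esub> b))" if b: "b \<in> carrier A" for b
        unfolding adjoint_orbit_def
      proof (intro conjI ballI)
        fix a c assume ac: "a \<in> carrier A" "c \<in> carrier A"
        show "ip H (e (star A a \<otimes>\<^bsub>A\<^esub> c)) (S b) = ip H (e c) (S (a \<otimes>\<^bsub>A\<^esub> b))"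
          using ac b \<phi>V \<psi>V R.rep_star[of "star A a" "\<pi> c \<phi>" "\<pi> b \<psi>"]
          by (simp add: S star_closed H.A.star_star R.rep_mult R.rep_closed)
      qed (use b S_closed in auto)
      have "adjoint_orbit A K d (T h) (\<lambda>a. T (k a))"
        unfolding adjoint_orbit_def
      proof (intro conjI ballI)
        show "T h \<in> carrier K"
          using hk T_closed by (simp add: adjoint_orbit_def)
        show "T (k a) \<in> carrier K" if "a \<in> carrier A" for a
          using hk that T_closed by (simp add: adjoint_orbit_def)
        fix a b assume ab: "a \<in> carrier A" "b \<in> carrier A"
        have "ip H (S (star A a \<otimes>\<^bsub>A\<^esub> b)) h = ip H (S b) (k a)"
          using H.symmetric[OF orbit_S[OF ab(2)] hk ab(1)] .
        then show "ip K (d (star A a \<otimes>\<^bsub>A\<^esub> b)) (T h) = ip K (d b) (T (k a))"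
          using hk ab by (simp add: T star_closed adjoint_orbit_def)
      qed
      from K.symmetric[OF this hk' a] show ?thesis .
    qed
  qed (use T_closed T_norm in auto)
qed

section \<open>Multiplication operators on square integrable functions\<close>

text \<open>The largest common domain of the multiplication operators in L^2. It is invariant under
  \<open>A\<close> because \<open>A\<close> is closed under products, and under bounded multipliers
  because only the size of \<open>u\<close> matters.\<close>

definition mult_domain :: "'x measure \<Rightarrow> ('x \<Rightarrow> complex) set \<Rightarrow> ('x \<Rightarrow> complex) set" where
  "mult_domain \<mu> A = {u \<in> borel_measurable \<mu>. \<forall>a\<in>A. integrable \<mu> (\<lambda>x. (cmod (a x * u x))\<^sup>2)}"

text \<open>Classes modulo null functions are represented by a chosen function, so that the space
  fits into the type over which the transition probability is formed.\<close>

definition ae_rep :: "'x measure \<Rightarrow> ('x \<Rightarrow> complex) \<Rightarrow> 'x \<Rightarrow> complex" where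
  "ae_rep \<mu> u = (SOME v. v \<in> borel_measurable \<mu> \<and> (AE x in \<mu>. v x = u x))"

definition ae_class :: "'x measure \<Rightarrow> ('x \<Rightarrow> complex) \<Rightarrow> ('x \<Rightarrow> complex) + 'd" where
  "ae_class \<mu> u = Inl (ae_rep \<mu> u)"

definition mult_space ::
  "'x measure \<Rightarrow> ('x \<Rightarrow> complex) set \<Rightarrow> (('x \<Rightarrow> complex) + 'd) ip_space" where
  "mult_space \<mu> A =
     \<lparr>carrier = ae_class \<mu> ` mult_domain \<mu> A,
      monoid.mult = (\<lambda>u v. undefined), one = undefined,
      ring.zero = ae_class \<mu> (\<lambda>x. 0),
      add = (\<lambda>u v. ae_class \<mu> (\<lambda>x. projl u x + projl v x)),
      smult = (\<lambda>c u. ae_class \<mu> (\<lambda>x. c * projl u x)),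
      ip = (\<lambda>u v. \<integral>x. projl u x * cnj (projl v x) \<partial>\<mu>)\<rparr>"

definition mult_rep ::
  "'x measure \<Rightarrow> ('x \<Rightarrow> complex) \<Rightarrow> ('x \<Rightarrow> complex) + 'd \<Rightarrow> ('x \<Rightarrow> complex) + 'd" where
  "mult_rep \<mu> a u = ae_class \<mu> (\<lambda>x. a x * projl u x)"

lemma borel_measurable_cnj [measurable (raw)]:
  "f \<in> borel_measurable M \<Longrightarrow> (\<lambda>x. cnj (f x)) \<in> borel_measurable M"
  by (rule measurable_compose[of f M borel cnj])
    (auto intro!: borel_measurable_continuous_onI continuous_intros)

lemma ae_rep_props:
  assumes "u \<in> borel_measurable \<mu>"
  shows "ae_rep \<mu> u \<in> borel_measurable \<mu>" "AE x in \<mu>. ae_rep \<mu> u x = u x"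
proof -
  have "u \<in> borel_measurable \<mu> \<and> (AE x in \<mu>. u x = u x)"
    using assms by simp
  from someI[of "\<lambda>v. v \<in> borel_measurable \<mu> \<and> (AE x in \<mu>. v x = u x)", OF this]
  show "ae_rep \<mu> u \<in> borel_measurable \<mu>" "AE x in \<mu>. ae_rep \<mu> u x = u x"
    by (auto simp: ae_rep_def)
qed

text \<open>The two predicates under the choice operator coincide, so equality almost everywhere
  becomes equality of the chosen functions.\<close>

lemma ae_rep_cong:
  assumes "AE x in \<mu>. u x = v x"
  shows "ae_rep \<mu> u = ae_rep \<mu> v"
proof -
  have "(AE x in \<mu>. w x = u x) \<longleftrightarrow> (AE x in \<mu>. w x = v x)" for w :: "'a \<Rightarrow> complex"
    by (rule eventually_subst) (use assms in eventually_elim, simp)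
  then show ?thesis
    by (simp add: ae_rep_def)
qed

section \<open>The domain \<open>D\<close> and the representation of \<open>A\<close> on its
  classes\<close>

locale function_algebra =
  fixes A :: "('x::t2_space \<Rightarrow> complex) set" and \<mu> :: "'x measure"
  assumes subalgebra: "star_subalgebra A cont_functions"
    and one_A: "(\<lambda>x. 1) \<in> A"
    and integrable_A: "a \<in> A \<Longrightarrow> integrable \<mu> a"
begin

abbreviation "D \<equiv> mult_domain \<mu> A"

abbreviation L2_norm :: "('x \<Rightarrow> complex) \<Rightarrow> real" where
  "L2_norm u \<equiv> sqrt (\<integral>x. (cmod (u x))\<^sup>2 \<partial>\<mu>)"

lemma A_add: "\<lbrakk>a \<in> A; b \<in> A\<rbrakk> \<Longrightarrow> (\<lambda>x. a x + b x) \<in> A"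
  and A_mult: "\<lbrakk>a \<in> A; b \<in> A\<rbrakk> \<Longrightarrow> (\<lambda>x. a x * b x) \<in> A"
  and A_smult: "a \<in> A \<Longrightarrow> (\<lambda>x. c * a x) \<in> A"
  and A_cnj: "a \<in> A \<Longrightarrow> (\<lambda>x. cnj (a x)) \<in> A"
  using subalgebra by (auto simp: star_subalgebra_def cont_functions_def)

lemma A_continuous: "a \<in> A \<Longrightarrow> continuous_on UNIV a"
  using subalgebra by (auto simp: star_subalgebra_def cont_functions_def)

lemma A_measurable: "a \<in> A \<Longrightarrow> a \<in> borel_measurable \<mu>"
  by (rule borel_measurable_integrable[OF integrable_A])

text \<open>The constant 1 belongs to \<open>A\<close> and is therefore integrable.\<close>

lemma finite_measure: "finite_measure \<mu>"
proof (rule finite_measureI)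
  have "(\<integral>\<^sup>+x. ennreal (norm (1::complex)) \<partial>\<mu>) < \<infinity>"
    using integrable_A[OF one_A] unfolding integrable_iff_bounded by (rule conjunct2)
  then show "emeasure \<mu> (space \<mu>) \<noteq> \<infinity>"
    by simp
qed

lemma D_measurable: "u \<in> D \<Longrightarrow> u \<in> borel_measurable \<mu>"
  by (simp add: mult_domain_def)

lemma D_integrable: "u \<in> D \<Longrightarrow> a \<in> A \<Longrightarrow> integrable \<mu> (\<lambda>x. (cmod (a x * u x))\<^sup>2)"
  by (simp add: mult_domain_def)

lemma D_square_integrable: "u \<in> D \<Longrightarrow> integrable \<mu> (\<lambda>x. (cmod (u x))\<^sup>2)"
  using D_integrable[OF _ one_A] by simp

lemma D_ip_integrable:
  assumes "u \<in> D" "v \<in> D"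
  shows "integrable \<mu> (\<lambda>x. u x * cnj (v x))"
proof (rule Bochner_Integration.integrable_bound)
  show "integrable \<mu> (\<lambda>x. (cmod (u x))\<^sup>2 + (cmod (v x))\<^sup>2)"
    using assms by (intro Bochner_Integration.integrable_add D_square_integrable)
  show "(\<lambda>x. u x * cnj (v x)) \<in> borel_measurable \<mu>"
    using assms[THEN D_measurable] by measurable
  have "cmod z * cmod w \<le> (cmod z)\<^sup>2 + (cmod w)\<^sup>2" for z w
    using sum_squares_bound[of "cmod z" "cmod w"] mult_nonneg_nonneg[OF norm_ge_zero norm_ge_zero, of z w] by linarith
  then show "AE x in \<mu>. norm (u x * cnj (v x)) \<le> norm ((cmod (u x))\<^sup>2 + (cmod (v x))\<^sup>2)"
    by (simp add: norm_mult)
qed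

lemma D_add:
  assumes "u \<in> D" "v \<in> D"
  shows "(\<lambda>x. u x + v x) \<in> D"
proof -
  have "integrable \<mu> (\<lambda>x. (cmod (a x * (u x + v x)))\<^sup>2)" if a: "a \<in> A" for a
  proof (rule Bochner_Integration.integrable_bound)
    show "integrable \<mu> (\<lambda>x. 2 * (cmod (a x * u x))\<^sup>2 + 2 * (cmod (a x * v x))\<^sup>2)"
      using assms a by (intro Bochner_Integration.integrable_add integrable_mult_right D_integrable) auto
    show "(\<lambda>x. (cmod (a x * (u x + v x)))\<^sup>2) \<in> borel_measurable \<mu>"
      using assms[THEN D_measurable] A_measurable[OF a] by measurable
    have "(cmod (z + w))\<^sup>2 \<le> 2 * (cmod z)\<^sup>2 + 2 * (cmod w)\<^sup>2" for z w
    proof -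
      have "(cmod (z + w))\<^sup>2 \<le> (cmod z + cmod w)\<^sup>2"
        by (intro power_mono norm_triangle_ineq) simp
      also have "\<dots> \<le> 2 * (cmod z)\<^sup>2 + 2 * (cmod w)\<^sup>2"
        using sum_squares_bound[of "cmod z" "cmod w"] by (simp add: power2_sum)
      finally show ?thesis .
    qed
    then show "AE x in \<mu>. norm ((cmod (a x * (u x + v x)))\<^sup>2)
        \<le> norm (2 * (cmod (a x * u x))\<^sup>2 + 2 * (cmod (a x * v x))\<^sup>2)"
      by (simp add: distrib_left)
  qed
  then show ?thesis
    using assms by (auto simp: mult_domain_def)
qed

lemma D_mult_bounded:
  assumes u: "u \<in> D" and b: "b \<in> borel_measurable \<mu>" "\<And>x. cmod (b x) \<le> C"
  shows "(\<lambda>x. b x * u x) \<in> D"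
proof -
  have "integrable \<mu> (\<lambda>x. (cmod (a x * (b x * u x)))\<^sup>2)" if a: "a \<in> A" for a
  proof (rule Bochner_Integration.integrable_bound)
    show "integrable \<mu> (\<lambda>x. C\<^sup>2 * (cmod (a x * u x))\<^sup>2)"
      using u a by (intro integrable_mult_right D_integrable)
    show "(\<lambda>x. (cmod (a x * (b x * u x)))\<^sup>2) \<in> borel_measurable \<mu>"
      using D_measurable[OF u] A_measurable[OF a] b by measurable
    have "(cmod (a x * (b x * u x)))\<^sup>2 \<le> C\<^sup>2 * (cmod (a x * u x))\<^sup>2" for x
    proof -
      have "cmod (a x * (b x * u x)) \<le> C * cmod (a x * u x)"
        using mult_right_mono[OF b(2)[of x], of "cmod (a x * u x)"] by (simp add: norm_mult mult_ac)
      then have "(cmod (a x * (b x * u x)))\<^sup>2 \<le> (C * cmod (a x * u x))\<^sup>2"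
        by (rule power_mono) simp
      then show ?thesis
        by (simp add: power_mult_distrib)
    qed
    then show "AE x in \<mu>. norm ((cmod (a x * (b x * u x)))\<^sup>2) \<le> norm (C\<^sup>2 * (cmod (a x * u x))\<^sup>2)"
      by simp
  qed
  then show ?thesis
    using assms by (auto simp: mult_domain_def)
qed

lemma D_smult: "u \<in> D \<Longrightarrow> (\<lambda>x. c * u x) \<in> D"
  by (rule D_mult_bounded[of u "\<lambda>x. c" "cmod c"]) auto

lemma D_mult_A:
  assumes "u \<in> D" "a \<in> A"
  shows "(\<lambda>x. a x * u x) \<in> D"
proof -
  have "integrable \<mu> (\<lambda>x. (cmod (b x * (a x * u x)))\<^sup>2)" if "b \<in> A" for b
    using D_integrable[OF assms(1) A_mult[OF that assms(2)]] by (simp add: mult.assoc)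
  moreover have "(\<lambda>x. a x * u x) \<in> borel_measurable \<mu>"
    using D_measurable[OF assms(1)] A_measurable[OF assms(2)] by measurable
  ultimately show ?thesis
    by (simp add: mult_domain_def)
qed

text \<open>With \<open>a\<close> also \<open>a * cnj a\<close> lies in \<open>A\<close>, so
  integrability of the elements of \<open>A\<close> already gives square integrability. This puts
  the constant 1 into \<open>D\<close>.\<close>

lemma bounded_in_D:
  assumes p: "p \<in> borel_measurable \<mu>" "\<And>x. cmod (p x) \<le> C"
  shows "p \<in> D"
proof -
  have "integrable \<mu> (\<lambda>x. (cmod (a x))\<^sup>2)" if a: "a \<in> A" for a
    using integrable_norm[OF integrable_A[OF A_mult[OF a A_cnj[OF a]]]]
    by (simp add: norm_mult power2_eq_square)
  then have "(\<lambda>x. 1) \<in> D"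
    by (simp add: mult_domain_def)
  from D_mult_bounded[OF this p] show ?thesis
    by simp
qed

lemma add_ae_class:
  assumes "u \<in> D" "v \<in> D"
  shows "ae_class \<mu> u \<oplus>\<^bsub>mult_space \<mu> A\<^esub> ae_class \<mu> v = ae_class \<mu> (\<lambda>x. u x + v x)"
  using ae_rep_props(2)[OF D_measurable[OF assms(1)]] ae_rep_props(2)[OF D_measurable[OF assms(2)]]
  by (simp add: mult_space_def ae_class_def, intro ae_rep_cong, eventually_elim) simp

lemma smult_ae_class:
  assumes "u \<in> D"
  shows "c \<odot>\<^bsub>mult_space \<mu> A\<^esub> ae_class \<mu> u = ae_class \<mu> (\<lambda>x. c * u x)"
  using ae_rep_props(2)[OF D_measurable[OF assms(1)]]
  by (simp add: mult_space_def ae_class_def, intro ae_rep_cong, eventually_elim) simp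

lemma mult_rep_ae_class:
  assumes "u \<in> D"
  shows "mult_rep \<mu> a (ae_class \<mu> u) = ae_class \<mu> (\<lambda>x. a x * u x)"
  using ae_rep_props(2)[OF D_measurable[OF assms(1)]]
  by (simp add: mult_rep_def ae_class_def, intro ae_rep_cong, eventually_elim) simp

lemma ip_ae_class:
  assumes "u \<in> D" "v \<in> D"
  shows "ip (mult_space \<mu> A) (ae_class \<mu> u) (ae_class \<mu> v) = (\<integral>x. u x * cnj (v x) \<partial>\<mu>)"
proof -
  note u = ae_rep_props[OF D_measurable[OF assms(1)]]
  note v = ae_rep_props[OF D_measurable[OF assms(2)]]
  have "(\<integral>x. ae_rep \<mu> u x * cnj (ae_rep \<mu> v x) \<partial>\<mu>) = (\<integral>x. u x * cnj (v x) \<partial>\<mu>)"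
  proof (rule integral_cong_AE)
    show "AE x in \<mu>. ae_rep \<mu> u x * cnj (ae_rep \<mu> v x) = u x * cnj (v x)"
      using u(2) v(2) by eventually_elim simp
  qed (use u(1) v(1) assms[THEN D_measurable] in measurable)
  then show ?thesis
    by (simp add: mult_space_def ae_class_def)
qed

lemma carrier_mult_space: "carrier (mult_space \<mu> A) = ae_class \<mu> ` D"
  by (simp add: mult_space_def)

lemma zero_mult_space: "\<zero>\<^bsub>mult_space \<mu> A\<^esub> = ae_class \<mu> (\<lambda>x. 0)"
  by (simp add: mult_space_def)

lemma zero_in_D: "(\<lambda>x. 0) \<in> D"
  by (simp add: mult_domain_def)

lemma ip_self_eq: "(\<integral>x. u x * cnj (u x) \<partial>\<mu>) = complex_of_real (\<integral>x. (cmod (u x))\<^sup>2 \<partial>\<mu>)"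
proof -
  have "(\<integral>x. u x * cnj (u x) \<partial>\<mu>) = (\<integral>x. complex_of_real ((cmod (u x))\<^sup>2) \<partial>\<mu>)"
    by (simp add: complex_norm_square del: of_real_power)
  also have "\<dots> = complex_of_real (\<integral>x. (cmod (u x))\<^sup>2 \<partial>\<mu>)"
    by (rule integral_complex_of_real)
  finally show ?thesis .
qed

lemma integral_ip_cnj: "(\<integral>x. v x * cnj (u x) \<partial>\<mu>) = cnj (\<integral>x. u x * cnj (v x) \<partial>\<mu>)"
  using Bochner_Integration.integral_cnj[of \<mu> "\<lambda>x. u x * cnj (v x)"] by (simp add: mult.commute)

lemma complex_ip_space_mult_space:
  "complex_ip_space (mult_space \<mu> A :: (('x \<Rightarrow> complex) + 'd) ip_space)"
proof -
  let ?V = "mult_space \<mu> A :: (('x \<Rightarrow> complex) + 'd) ip_space"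
  have C: "carrier complex_ring = UNIV" "monoid.mult complex_ring = (*)" "one complex_ring = 1"
    "add complex_ring = (+)"
    by (simp_all add: ring_of_type_algebra_def)
  note [simp] = add_ae_class smult_ae_class ip_ae_class zero_in_D D_add D_smult
  note V = carrier_mult_space zero_mult_space
  have ab: "abelian_group ?V"
  proof (rule abelian_groupI)
    show "\<exists>b\<in>carrier ?V. b \<oplus>\<^bsub>?V\<^esub> a = \<zero>\<^bsub>?V\<^esub>" if a: "a \<in> carrier ?V" for a
    proof -
      obtain u where "u \<in> D" "a = ae_class \<mu> u"
        using a by (auto simp: V)
      then show ?thesis
        using D_smult[of u "-1"] by (intro bexI[of _ "ae_class \<mu> (\<lambda>x. -1 * u x)"]) (auto simp: V)
    qed
  qed (auto simp: V add_ac)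
  have cr: "cring complex_ring" ..
  have "Module.module complex_ring ?V"
    by (rule moduleI[OF cr ab]; unfold C) (auto simp: V algebra_simps)
  moreover have "complex_ip_space_axioms ?V"
  proof
    show "ip ?V (u \<oplus>\<^bsub>?V\<^esub> v) w = ip ?V u w + ip ?V v w"
      if "u \<in> carrier ?V" "v \<in> carrier ?V" "w \<in> carrier ?V" for u v w
      using that by (auto simp: V distrib_right D_ip_integrable)
    show "ip ?V (c \<odot>\<^bsub>?V\<^esub> v) w = c * ip ?V v w"
      if "v \<in> carrier ?V" "w \<in> carrier ?V" for v w c
      using that by (auto simp: V mult.assoc)
    show "ip ?V w v = cnj (ip ?V v w)" if "v \<in> carrier ?V" "w \<in> carrier ?V" for v w
      using that by (auto simp: V intro: integral_ip_cnj)
    show "ip ?V v v \<in> \<real>\<^sub>\<ge>\<^sub>0" if "v \<in> carrier ?V" for v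
      using that by (auto simp: V ip_self_eq)
    show "v = \<zero>\<^bsub>?V\<^esub>" if v: "v \<in> carrier ?V" "ip ?V v v = 0" for v
    proof -
      obtain u where u: "u \<in> D" "v = ae_class \<mu> u"
        using v by (auto simp: V)
      then have "(\<integral>x. (cmod (u x))\<^sup>2 \<partial>\<mu>) = 0"
        using v(2) by (simp add: ip_self_eq)
      then have "AE x in \<mu>. (cmod (u x))\<^sup>2 = 0"
        by (subst (asm) integral_nonneg_eq_0_iff_AE) (use u D_square_integrable in auto)
      then show ?thesis
        unfolding u(2) V ae_class_def by (intro arg_cong[where f = Inl] ae_rep_cong) auto
    qed
  qed
  ultimately show ?thesis
    by (simp add: complex_ip_space_def)
qed

lemma star_rep_mult_rep:
  "star_rep (cont_functions\<lparr>carrier := A\<rparr>) (mult_space \<mu> A :: (('x \<Rightarrow> complex) + 'd) ip_space) (mult_rep \<mu>)"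
proof -
  let ?V = "mult_space \<mu> A :: (('x \<Rightarrow> complex) + 'd) ip_space"
  let ?A = "cont_functions\<lparr>carrier := A\<rparr>"
  have B: "carrier ?A = A" "monoid.mult ?A = (\<lambda>a b x. a x * b x)" "one ?A = (\<lambda>x. 1)"
    "add ?A = (\<lambda>a b x. a x + b x)"
    "smult ?A = (\<lambda>c a x. c * a x)" "star ?A = (\<lambda>a x. cnj (a x))"
    by (simp_all add: cont_functions_def)
  note [simp] = add_ae_class smult_ae_class ip_ae_class mult_rep_ae_class D_add D_smult D_mult_A A_add A_mult A_smult A_cnj
  have "star_rep_axioms ?A ?V (mult_rep \<mu>)"
    by (rule star_rep_axioms.intro; unfold B; auto simp: carrier_mult_space; simp add: algebra_simps)
  then show ?thesis
    using star_algebra_cont_functions_subalgebra[OF subalgebra one_A]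
      complex_ip_space_mult_space by (simp add: star_rep_def)
qed

lemma L2_cauchy_schwarz:
  assumes "u \<in> D" "v \<in> D"
  shows "cmod (\<integral>x. u x * cnj (v x) \<partial>\<mu>) \<le> L2_norm u * L2_norm v"
proof -
  interpret complex_ip_space "mult_space \<mu> A :: (('x \<Rightarrow> complex) + unit) ip_space"
    by (rule complex_ip_space_mult_space)
  show ?thesis
    using cauchy_schwarz[of "ae_class \<mu> u" "ae_class \<mu> v"] assms
    by (simp add: ip_norm_def ip_ae_class ip_self_eq carrier_mult_space)
qed

end

section \<open>Forms commuting with multiplication\<close>

text \<open>\<open>B\<close> takes functions rather than classes; additivity and
  \<open>B_bound\<close> make it insensitive to null sets. \<open>B_commutes\<close> covers only the
  possibly unbounded elements of \<open>A\<close>, and the task is to carry it over to bounded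
  measurable functions.\<close>

locale commuting_form = function_algebra A \<mu>
  for A :: "('x::t2_space \<Rightarrow> complex) set" and \<mu> :: "'x measure" +
  fixes B :: "('x \<Rightarrow> complex) \<Rightarrow> ('x \<Rightarrow> complex) \<Rightarrow> complex"
  assumes separating: "x \<noteq> y \<Longrightarrow> \<exists>a\<in>A. a x \<noteq> a y"
    and regular: "regular_borel_measure \<mu>"
    and B_add_left: "\<lbrakk>u \<in> D; u' \<in> D; v \<in> D\<rbrakk> \<Longrightarrow> B (\<lambda>x. u x + u' x) v = B u v + B u' v"
    and B_add_right: "\<lbrakk>u \<in> D; v \<in> D; v' \<in> D\<rbrakk> \<Longrightarrow> B u (\<lambda>x. v x + v' x) = B u v + B u v'"
    and B_smult_left: "\<lbrakk>u \<in> D; v \<in> D\<rbrakk> \<Longrightarrow> B (\<lambda>x. c * u x) v = c * B u v"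
    and B_smult_right: "\<lbrakk>u \<in> D; v \<in> D\<rbrakk> \<Longrightarrow> B u (\<lambda>x. c * v x) = cnj c * B u v"
    and B_bound: "\<lbrakk>u \<in> D; v \<in> D\<rbrakk> \<Longrightarrow> cmod (B u v) \<le> L2_norm u * L2_norm v"
    and B_commutes: "\<lbrakk>u \<in> D; v \<in> D; a \<in> A\<rbrakk> \<Longrightarrow> B (\<lambda>x. a x * u x) v = B u (\<lambda>x. cnj (a x) * v x)"
begin

section \<open>The algebra of bounded real multipliers that commute with the form\<close>

lemma sets_eq: "sets \<mu> = sets borel"
  using regular by (simp add: regular_borel_measure_def)

lemma space_eq: "space \<mu> = UNIV"
  using sets_eq_imp_space_eq[OF sets_eq] by simp

text \<open>Restricting to real functions removes the conjugation on the right. Boundedness keeps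
  \<open>D\<close> invariant, so balanced functions form a real algebra on which products and limits
  can be taken.\<close>

definition balanced :: "('x \<Rightarrow> real) \<Rightarrow> bool" where
  "balanced b \<longleftrightarrow> b \<in> borel_measurable \<mu> \<and> (\<exists>C. \<forall>x. \<bar>b x\<bar> \<le> C) \<and>
     (\<forall>u\<in>D. \<forall>v\<in>D. B (\<lambda>x. of_real (b x) * u x) v = B u (\<lambda>x. of_real (b x) * v x))"

lemma balancedI:
  assumes "b \<in> borel_measurable \<mu>" "\<And>x. \<bar>b x\<bar> \<le> C"
    and "\<And>u v. \<lbrakk>u \<in> D; v \<in> D\<rbrakk> \<Longrightarrow> B (\<lambda>x. of_real (b x) * u x) v = B u (\<lambda>x. of_real (b x) * v x)"
  shows "balanced b"
  using assms by (auto simp: balanced_def)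

lemma balancedD:
  assumes "balanced b" "u \<in> D" "v \<in> D"
  shows "B (\<lambda>x. of_real (b x) * u x) v = B u (\<lambda>x. of_real (b x) * v x)"
  using assms by (auto simp: balanced_def)

lemma balanced_measurable: "balanced b \<Longrightarrow> b \<in> borel_measurable \<mu>"
  by (simp add: balanced_def)

lemma D_mult_real:
  assumes "u \<in> D" "b \<in> borel_measurable \<mu>" "\<And>x. \<bar>b x\<bar> \<le> C"
  shows "(\<lambda>x. of_real (b x) * u x) \<in> D"
  by (rule D_mult_bounded[where C = C]) (use assms in auto)

lemma D_mult_balanced:
  assumes "u \<in> D" "balanced b"
  shows "(\<lambda>x. of_real (b x) * u x) \<in> D"
proof -
  obtain C where "\<forall>x. \<bar>b x\<bar> \<le> C" "b \<in> borel_measurable \<mu>"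
    using assms(2) by (auto simp: balanced_def)
  then show ?thesis
    using D_mult_real[OF assms(1)] by blast
qed

lemma balanced_const: "balanced (\<lambda>x. c)"
  by (rule balancedI[where C = "\<bar>c\<bar>"]) (simp_all add: B_smult_left B_smult_right)

lemma balanced_add:
  assumes "balanced b" "balanced c"
  shows "balanced (\<lambda>x. b x + c x)"
proof -
  obtain C1 C2 where C: "\<And>x. \<bar>b x\<bar> \<le> C1" "\<And>x. \<bar>c x\<bar> \<le> C2"
    using assms by (auto simp: balanced_def)
  show ?thesis
  proof (rule balancedI[where C = "C1 + C2"])
    show "\<bar>b x + c x\<bar> \<le> C1 + C2" for x
      using C(1)[of x] C(2)[of x] by linarith
    show "B (\<lambda>x. of_real (b x + c x) * u x) v = B u (\<lambda>x. of_real (b x + c x) * v x)"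
      if uv: "u \<in> D" "v \<in> D" for u v
      using assms uv
      by (simp add: distrib_right B_add_left B_add_right D_mult_balanced balancedD)
  qed (use assms[THEN balanced_measurable] in measurable)
qed

lemma balanced_mult:
  assumes "balanced b" "balanced c"
  shows "balanced (\<lambda>x. b x * c x)"
proof -
  obtain C1 C2 where C: "\<And>x. \<bar>b x\<bar> \<le> C1" "\<And>x. \<bar>c x\<bar> \<le> C2"
    using assms by (auto simp: balanced_def)
  show ?thesis
  proof (rule balancedI[where C = "C1 * C2"])
    show "\<bar>b x * c x\<bar> \<le> C1 * C2" for x
      unfolding abs_mult using C(1)[of x] C(2)[of x] by (intro mult_mono) auto
    show "B (\<lambda>x. of_real (b x * c x) * u x) v = B u (\<lambda>x. of_real (b x * c x) * v x)"
      if uv: "u \<in> D" "v \<in> D" for u v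
    proof -
      have "B (\<lambda>x. of_real (b x) * (of_real (c x) * u x)) v = B u (\<lambda>x. of_real (c x) * (of_real (b x) * v x))"
        using assms uv by (simp add: D_mult_balanced balancedD)
      then show ?thesis
        by (simp add: mult_ac)
    qed
  qed (use assms[THEN balanced_measurable] in measurable)
qed

text \<open>The unbounded \<open>a\<close> is replaced by the real and imaginary parts of its resolvent \<open>1 / (a + i)\<close>.\<close>

lemma balanced_resolvent:
  assumes a: "a \<in> A" "\<And>x. a x = of_real (r x)"
  shows "balanced (\<lambda>x. 1 / ((r x)\<^sup>2 + 1))" "balanced (\<lambda>x. r x / ((r x)\<^sup>2 + 1))"
proof -
  let ?c = "\<lambda>x. 1 / ((r x)\<^sup>2 + 1)"
  have "r = (\<lambda>x. Re (a x))"
    using a(2) by auto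
  then have r [measurable]: "r \<in> borel_measurable \<mu>"
    using A_measurable[OF a(1)] by simp
  have pos: "(r x)\<^sup>2 + 1 > 0" for x
    by (simp add: add_nonneg_pos)
  have c1: "\<bar>?c x\<bar> \<le> 1" for x
  proof -
    have "\<bar>?c x\<bar> = ?c x"
      using pos[of x] by simp
    also have "\<dots> \<le> 1"
      unfolding pos_divide_le_eq[OF pos] by simp
    finally show ?thesis .
  qed
  have c2: "\<bar>r x / ((r x)\<^sup>2 + 1)\<bar> \<le> 1" for x
  proof -
    have "2 * \<bar>r x\<bar> \<le> (r x)\<^sup>2 + 1"
      using zero_le_power2[of "\<bar>r x\<bar> - 1"] by (simp add: power2_diff)
    then have "\<bar>r x\<bar> \<le> (r x)\<^sup>2 + 1"
      using abs_ge_zero[of "r x"] by linarith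
    then have "r x \<le> (r x)\<^sup>2 + 1" "- r x \<le> (r x)\<^sup>2 + 1"
      by linarith+
    then show ?thesis
      unfolding abs_le_iff minus_divide_left pos_divide_le_eq[OF pos] mult_1 by (rule conjI)
  qed
  have A2: "(\<lambda>x. a x * a x + 1) \<in> A"
    using a(1) by (intro A_add A_mult one_A)
  have real_mult: "B (\<lambda>x. f x * u x) v = B u (\<lambda>x. f x * v x)"
    if "f \<in> A" "\<And>x. cnj (f x) = f x" "u \<in> D" "v \<in> D" for f u v
    using B_commutes[OF that(3,4,1)] that(2) by simp
  have cD: "(\<lambda>x. of_real (?c x) * u x) \<in> D" if "u \<in> D" for u
    using that c1 by (intro D_mult_real[where C = 1]) auto
  have cancel: "(a x * a x + 1) * (of_real (?c x) * z) = z" for x z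
  proof -
    have "of_real s * (of_real (1 / s) * z) = z" if "s \<noteq> 0" for s
      using that by simp
    moreover have "a x * a x + 1 = of_real ((r x)\<^sup>2 + 1)"
      by (simp add: a(2) power2_eq_square)
    ultimately show ?thesis
      using pos[of x] by (simp only:)
  qed
  \<comment> \<open>With g = a^2 + 1 in \<open>A\<close>, \<open>v\<close> is written as g c v. Now
    g moves to the left, where it cancels against the c on \<open>u\<close>, while f moves to the
    right and meets the c left on \<open>v\<close>. Every intermediate vector lies in
    \<open>D\<close>. Taking f = 1 and f = a gives the two claims.\<close>
  have swap: "B (\<lambda>x. f x * (of_real (?c x) * u x)) v = B u (\<lambda>x. f x * (of_real (?c x) * v x))"
    if f: "f \<in> A" "\<And>x. cnj (f x) = f x" and u: "u \<in> D" and v: "v \<in> D" for f u v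
  proof -
    let ?u = "\<lambda>x. of_real (?c x) * u x" and ?v = "\<lambda>x. of_real (?c x) * v x"
    let ?g = "\<lambda>x. a x * a x + 1"
    have g: "cnj (?g x) = ?g x" for x
      by (simp add: a(2))
    have "B (\<lambda>x. f x * ?u x) (\<lambda>x. ?g x * ?v x) = B (\<lambda>x. ?g x * (f x * ?u x)) ?v"
      by (rule real_mult[OF A2 g D_mult_A[OF cD[OF u] f(1)] cD[OF v], symmetric])
    also have "\<dots> = B (\<lambda>x. f x * (?g x * ?u x)) ?v"
      by (simp add: mult_ac)
    also have "\<dots> = B (\<lambda>x. ?g x * ?u x) (\<lambda>x. f x * ?v x)"
      by (rule real_mult[OF f D_mult_A[OF cD[OF u] A2] cD[OF v]])
    finally show ?thesis
      unfolding cancel .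
  qed
  show "balanced ?c"
    using swap[OF one_A] c1 by (intro balancedI[where C = 1]) auto
  show "balanced (\<lambda>x. r x / ((r x)\<^sup>2 + 1))"
  proof (rule balancedI[OF _ c2])
    fix u v assume uv: "u \<in> D" "v \<in> D"
    show "B (\<lambda>x. of_real (r x / ((r x)\<^sup>2 + 1)) * u x) v = B u (\<lambda>x. of_real (r x / ((r x)\<^sup>2 + 1)) * v x)"
      using swap[OF a(1) _ uv] by (simp add: a(2))
  qed measurable
qed

text \<open>Dominated convergence gives (b_n - c) w -> 0 in L^2 for each w in \<open>D\<close>, and
  \<open>B_bound\<close> makes both sides of the relation converge. Since only L^2 norms enter,
  convergence almost everywhere suffices.\<close>

lemma balanced_limit:
  assumes b: "\<And>n. balanced (b n)" and C: "\<And>n x. \<bar>b n x\<bar> \<le> C"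
    and c: "c \<in> borel_measurable \<mu>" "\<And>x. \<bar>c x\<bar> \<le> C"
    and lim: "AE x in \<mu>. (\<lambda>n. b n x) \<longlonglongrightarrow> c x"
  shows "balanced c"
proof (rule balancedI[OF c])
  fix u v assume u: "u \<in> D" and v: "v \<in> D"
  note b_meas = balanced_measurable[OF b]
  have diff: "(\<lambda>x. of_real (b n x - c x) * w x) \<in> D" if "w \<in> D" for n w
  proof (rule D_mult_real[OF that])
    show "\<bar>b n x - c x\<bar> \<le> C + C" for x
      using C[of n x] c(2)[of x] by linarith
  qed (use b_meas[of n] c in measurable)
  have norm0: "(\<lambda>n. L2_norm (\<lambda>x. of_real (b n x - c x) * w x)) \<longlonglongrightarrow> 0" if w: "w \<in> D" for w
  proof -
    have "(\<lambda>n. \<integral>x. (cmod (of_real (b n x - c x) * w x))\<^sup>2 \<partial>\<mu>) \<longlonglongrightarrow> (\<integral>x. 0 \<partial>\<mu>)"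
    proof (rule integral_dominated_convergence)
      show "integrable \<mu> (\<lambda>x. (2 * C)\<^sup>2 * (cmod (w x))\<^sup>2)"
        using D_square_integrable[OF w] by simp
      show "(\<lambda>x. (cmod (of_real (b n x - c x) * w x))\<^sup>2) \<in> borel_measurable \<mu>" for n
        using D_measurable[OF w] b_meas[of n] c by measurable
      show "AE x in \<mu>. (\<lambda>n. (cmod (of_real (b n x - c x) * w x))\<^sup>2) \<longlonglongrightarrow> 0"
        using lim
      proof eventually_elim
        case (elim x)
        have "(\<lambda>n. (cmod (of_real (b n x - c x) * w x))\<^sup>2) \<longlonglongrightarrow> (cmod (of_real (c x - c x) * w x))\<^sup>2"
          by (intro tendsto_intros elim)
        then show ?case
          by simp
      qed
      show "AE x in \<mu>. norm ((cmod (of_real (b n x - c x) * w x))\<^sup>2) \<le> (2 * C)\<^sup>2 * (cmod (w x))\<^sup>2" for n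
      proof (rule AE_I2)
        fix x
        have "\<bar>b n x - c x\<bar> \<le> 2 * C"
          using C[of n x] c(2)[of x] by linarith
        then have "(cmod (of_real (b n x - c x) * w x))\<^sup>2 \<le> (2 * C * cmod (w x))\<^sup>2"
          unfolding norm_mult norm_of_real by (intro power_mono mult_right_mono) auto
        then show "norm ((cmod (of_real (b n x - c x) * w x))\<^sup>2) \<le> (2 * C)\<^sup>2 * (cmod (w x))\<^sup>2"
          by (simp add: power_mult_distrib)
      qed
    qed simp
    from tendsto_real_sqrt[OF this] show ?thesis
      by simp
  qed
  have cD: "(\<lambda>x. of_real (c x) * w x) \<in> D" if "w \<in> D" for w
    using D_mult_real[OF that c] .
  have split: "(\<lambda>x. of_real (b n x) * w x) = (\<lambda>x. of_real (b n x - c x) * w x + of_real (c x) * w x)" for n w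
    by (simp add: algebra_simps)
  have "(\<lambda>n. B (\<lambda>x. of_real (b n x - c x) * u x) v) \<longlonglongrightarrow> 0"
  proof (rule Lim_null_comparison)
    show "\<forall>\<^sub>F n in sequentially. norm (B (\<lambda>x. of_real (b n x - c x) * u x) v)
        \<le> L2_norm (\<lambda>x. of_real (b n x - c x) * u x) * L2_norm v"
      using B_bound[OF diff[OF u] v] by simp
    show "(\<lambda>n. L2_norm (\<lambda>x. of_real (b n x - c x) * u x) * L2_norm v) \<longlonglongrightarrow> 0"
      using norm0[OF u] by (rule tendsto_mult_left_zero)
  qed
  then have "(\<lambda>n. B (\<lambda>x. of_real (b n x - c x) * u x) v + B (\<lambda>x. of_real (c x) * u x) v)
      \<longlonglongrightarrow> 0 + B (\<lambda>x. of_real (c x) * u x) v"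
    by (intro tendsto_intros)
  then have left: "(\<lambda>n. B (\<lambda>x. of_real (b n x) * u x) v) \<longlonglongrightarrow> B (\<lambda>x. of_real (c x) * u x) v"
    by (subst split) (simp only: B_add_left[OF diff[OF u] cD[OF u] v] add_0_left)
  have "(\<lambda>n. B u (\<lambda>x. of_real (b n x - c x) * v x)) \<longlonglongrightarrow> 0"
  proof (rule Lim_null_comparison)
    show "\<forall>\<^sub>F n in sequentially. norm (B u (\<lambda>x. of_real (b n x - c x) * v x))
        \<le> L2_norm u * L2_norm (\<lambda>x. of_real (b n x - c x) * v x)"
      using B_bound[OF u diff[OF v]] by simp
    show "(\<lambda>n. L2_norm u * L2_norm (\<lambda>x. of_real (b n x - c x) * v x)) \<longlonglongrightarrow> 0"
      using norm0[OF v] by (rule tendsto_mult_right_zero)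
  qed
  then have "(\<lambda>n. B u (\<lambda>x. of_real (b n x - c x) * v x) + B u (\<lambda>x. of_real (c x) * v x))
      \<longlonglongrightarrow> 0 + B u (\<lambda>x. of_real (c x) * v x)"
    by (intro tendsto_intros)
  then have right: "(\<lambda>n. B u (\<lambda>x. of_real (b n x) * v x)) \<longlonglongrightarrow> B u (\<lambda>x. of_real (c x) * v x)"
    by (subst split) (simp only: B_add_right[OF u diff[OF v] cD[OF v]] add_0_left)
  show "B (\<lambda>x. of_real (c x) * u x) v = B u (\<lambda>x. of_real (c x) * v x)"
    using left right unfolding balancedD[OF b u v] by (rule LIMSEQ_unique)
qed

section \<open>Functional calculus and separation of points\<close>

lemma balanced_polynomial:
  fixes p :: "real \<Rightarrow> real"
  assumes "real_polynomial_function p" "balanced b"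
  shows "balanced (\<lambda>x. p (b x))"
  using assms(1)
proof induction
  case (linear p)
  have "p t = t * p 1" for t
    using linear_cmul[OF bounded_linear.linear[OF linear], of t 1] by simp
  then have "(\<lambda>x. p (b x)) = (\<lambda>x. b x * p 1)"
    by (intro ext)
  then show ?case
    using balanced_mult[OF assms(2) balanced_const[of "p 1"]] by simp
qed (simp_all add: balanced_const balanced_add balanced_mult)

text \<open>As \<open>b\<close> has values in a compact interval, polynomials approximate
  \<open>g\<close> there uniformly. The approximants stay within 1 of \<open>g\<close>, whence the
  common bound C + 1. The lemma serves to truncate balanced functions.\<close>

lemma balanced_continuous:
  fixes g :: "real \<Rightarrow> real"
  assumes b: "balanced b" and g: "continuous_on UNIV g" "\<And>t. \<bar>g t\<bar> \<le> C"
  shows "balanced (\<lambda>x. g (b x))"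
proof -
  obtain M where M: "\<And>x. \<bar>b x\<bar> \<le> M"
    using b by (auto simp: balanced_def)
  have "\<exists>p. real_polynomial_function p \<and> (\<forall>t\<in>{-M..M}. \<bar>g t - p t\<bar> < 1 / real (Suc n))" for n
  proof -
    obtain p where "real_polynomial_function p" "\<And>t. t \<in> {-M..M} \<Longrightarrow> \<bar>g t - p t\<bar> < 1 / real (Suc n)"
      using Stone_Weierstrass_real_polynomial_function[OF compact_Icc
          continuous_on_subset[OF g(1) subset_UNIV], of "1 / real (Suc n)" "-M" M] by auto
    then show ?thesis
      by blast
  qed
  then obtain p where p: "\<And>n. real_polynomial_function (p n)"
    and approx: "\<And>n t. t \<in> {-M..M} \<Longrightarrow> \<bar>g t - p n t\<bar> < 1 / real (Suc n)"
    by metis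
  have close: "\<bar>g (b x) - p n (b x)\<bar> < 1 / real (Suc n)" for n x
    using M[of x] by (intro approx) (auto simp: abs_le_iff)
  show ?thesis
  proof (rule balanced_limit[where C = "C + 1"])
    show "balanced (\<lambda>x. p n (b x))" for n
      by (rule balanced_polynomial[OF p b])
    have "1 / real (Suc n) \<le> 1" for n
      by simp
    then show "\<bar>p n (b x)\<bar> \<le> C + 1" for n x
      using close[of x n] g(2)[of "b x"] by (smt (verit, best))
    show "(\<lambda>x. g (b x)) \<in> borel_measurable \<mu>"
      using balanced_measurable[OF b] borel_measurable_continuous_onI[OF g(1)] by measurable
    show "\<bar>g (b x)\<bar> \<le> C + 1" for x
      using g(2)[of "b x"] by simp
    show "AE x in \<mu>. (\<lambda>n. p n (b x)) \<longlonglongrightarrow> g (b x)"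
    proof (rule AE_I2)
      fix x
      have "(\<lambda>n. g (b x) - p n (b x)) \<longlonglongrightarrow> 0"
      proof (rule Lim_null_comparison)
        show "\<forall>\<^sub>F n in sequentially. norm (g (b x) - p n (b x)) \<le> 1 / real (Suc n)"
          using close[of x] by (intro always_eventually allI less_imp_le) (simp only: real_norm_def)
        show "(\<lambda>n. 1 / real (Suc n)) \<longlonglongrightarrow> 0"
          using LIMSEQ_inverse_real_of_nat by (simp add: inverse_eq_divide)
      qed
      then have "(\<lambda>n. g (b x) - (g (b x) - p n (b x))) \<longlonglongrightarrow> g (b x) - 0"
        by (intro tendsto_intros)
      then show "(\<lambda>n. p n (b x)) \<longlonglongrightarrow> g (b x)"
        by simp
    qed
  qed
qed

text \<open>The map r -> 1/(r + i) is injective on the reals: if the values of 1/(r^2 + 1) agree, so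
  do the denominators, and then r/(r^2 + 1) tells the two points apart. The real function r is the
  real or imaginary part of a separating element of \<open>A\<close>.\<close>

lemma separating_balanced:
  assumes "x \<noteq> y"
  shows "\<exists>b. balanced b \<and> continuous_on UNIV b \<and> b x \<noteq> b y"
proof -
  obtain a where a: "a \<in> A" "a x \<noteq> a y"
    using separating[OF assms] by blast
  have Re: "(\<lambda>x. of_real (Re (a x))) \<in> A"
    using A_smult[OF A_add[OF a(1) A_cnj[OF a(1)]], of "1/2"] by (simp add: complex_add_cnj)
  have "- \<i> / 2 * (z + -1 * cnj z) = of_real (Im z)" for z
    by (simp add: complex_eq_iff)
  then have Im: "(\<lambda>x. of_real (Im (a x))) \<in> A"
    using A_smult[OF A_add[OF a(1) A_smult[OF A_cnj[OF a(1)], of "-1"]], of "- \<i> / 2"] by simp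
  obtain r where r: "(\<lambda>x. of_real (r x)) \<in> A" "r x \<noteq> r y" "continuous_on UNIV r"
    using a(2) Re Im continuous_on_Re[OF A_continuous[OF a(1)]] continuous_on_Im[OF A_continuous[OF a(1)]]
    by (metis complex_eq_iff)
  have pos: "(r z)\<^sup>2 + 1 > 0" for z
    by (simp add: add_nonneg_pos)
  then have nz: "(r z)\<^sup>2 + 1 \<noteq> 0" for z
    by (metis less_irrefl)
  show ?thesis
  proof (cases "1 / ((r x)\<^sup>2 + 1) = 1 / ((r y)\<^sup>2 + 1)")
    case False
    moreover have "continuous_on UNIV (\<lambda>x. 1 / ((r x)\<^sup>2 + 1))"
      using r(3) nz by (intro continuous_intros) auto
    ultimately show ?thesis
      using balanced_resolvent(1)[OF r(1), of r] by (intro exI[of _ "\<lambda>x. 1 / ((r x)\<^sup>2 + 1)"]) auto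
  next
    case True
    then have "(r x)\<^sup>2 + 1 = (r y)\<^sup>2 + 1"
      by (metis div_by_1 divide_divide_eq_right mult_1)
    then have "r x / ((r x)\<^sup>2 + 1) \<noteq> r y / ((r y)\<^sup>2 + 1)"
      using r(2) nz[of y] by simp
    moreover have "continuous_on UNIV (\<lambda>x. r x / ((r x)\<^sup>2 + 1))"
      using r(3) nz by (intro continuous_intros) auto
    ultimately show ?thesis
      using balanced_resolvent(2)[OF r(1), of r] by (intro exI[of _ "\<lambda>x. r x / ((r x)\<^sup>2 + 1)"]) auto
  qed
qed

section \<open>From continuous multipliers to measurable ones by regularity\<close>

sublocale finite_measure \<mu>
  by (rule finite_measure)

lemma inner_approximation:
  assumes E: "E \<in> sets borel" and e: "0 < e"
  obtains K where "compact K" "K \<subseteq> E" "measure \<mu> (E - K) < e"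
proof -
  have sup: "emeasure \<mu> E = (SUP K\<in>{K. K \<subseteq> E \<and> compact K}. emeasure \<mu> K)"
    using bspec[OF conjunct2[OF regular[unfolded regular_borel_measure_def]] E] by (rule conjunct2)
  have "\<exists>K. compact K \<and> K \<subseteq> E \<and> measure \<mu> E - e < measure \<mu> K"
  proof (rule ccontr)
    assume "\<not> ?thesis"
    then have le: "measure \<mu> K \<le> measure \<mu> E - e" if "compact K" "K \<subseteq> E" for K
      using that by (meson not_le_imp_less)
    have "emeasure \<mu> E \<le> ennreal (measure \<mu> E - e)"
      unfolding sup by (rule SUP_least) (use le in \<open>auto simp: emeasure_eq_measure intro!: ennreal_leI\<close>)
    \<comment> \<open>The empty compact set rules out a negative difference, which
      \<open>ennreal\<close> would send to 0 and so hide the contradiction.\<close>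
    moreover have "0 \<le> measure \<mu> E - e"
      using le[of "{}"] by simp
    ultimately show False
      using e by (simp add: emeasure_eq_measure)
  qed
  then obtain K where K: "compact K" "K \<subseteq> E" "measure \<mu> E - e < measure \<mu> K"
    by blast
  moreover have "measure \<mu> (E - K) = measure \<mu> E - measure \<mu> K"
    using K E by (intro finite_measure_Diff) (auto simp: sets_eq intro: borel_closed compact_imp_closed)
  ultimately show thesis
    by (intro that[of K]) auto
qed

lemma outer_approximation:
  assumes E: "E \<in> sets borel" and e: "0 < e"
  obtains U where "open U" "E \<subseteq> U" "measure \<mu> (U - E) < e"
proof -
  have inf: "emeasure \<mu> E = (INF U\<in>{U. E \<subseteq> U \<and> open U}. emeasure \<mu> U)"
    using bspec[OF conjunct2[OF regular[unfolded regular_borel_measure_def]] E] by (rule conjunct1)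
  have "\<exists>U. open U \<and> E \<subseteq> U \<and> measure \<mu> U < measure \<mu> E + e"
  proof (rule ccontr)
    assume "\<not> ?thesis"
    then have ge: "measure \<mu> E + e \<le> measure \<mu> U" if "open U" "E \<subseteq> U" for U
      using that by (meson not_le_imp_less)
    have "ennreal (measure \<mu> E + e) \<le> emeasure \<mu> E"
      unfolding inf by (rule INF_greatest) (use ge in \<open>auto simp: emeasure_eq_measure intro!: ennreal_leI\<close>)
    then show False
      using e by (simp add: emeasure_eq_measure)
  qed
  then obtain U where U: "open U" "E \<subseteq> U" "measure \<mu> U < measure \<mu> E + e"
    by blast
  moreover have "measure \<mu> (U - E) = measure \<mu> U - measure \<mu> E"
    using U E by (intro finite_measure_Diff) (auto simp: sets_eq)
  ultimately show thesis
    by (intro that[of U]) auto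
qed

text \<open>The measures of the exceptional sets are summable, so almost every x lies in only
  finitely many \<open>N n\<close>, and there b_n x converges to c x.\<close>

lemma balanced_borel_cantelli:
  assumes b: "\<And>n. balanced (b n)" "\<And>n x. \<bar>b n x\<bar> \<le> C"
    and c: "c \<in> borel_measurable \<mu>" "\<And>x. \<bar>c x\<bar> \<le> C"
    and N: "\<And>n. N n \<in> sets \<mu>" "\<And>n. measure \<mu> (N n) \<le> (1/2) ^ n"
    and close: "\<And>n x. x \<notin> N n \<Longrightarrow> \<bar>b n x - c x\<bar> \<le> (1/2) ^ n"
  shows "balanced c"
proof (rule balanced_limit[OF b c])
  have "summable (\<lambda>n. measure \<mu> (N n))"
    by (rule summable_comparison_test'[of "\<lambda>n. (1/2) ^ n" 0]) (use N(2) in \<open>auto intro: summable_geometric\<close>)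
  then have "AE x in \<mu>. \<forall>\<^sub>F n in sequentially. x \<in> space \<mu> - N n"
    by (intro borel_cantelli_AE1 N) (auto simp: emeasure_eq_measure)
  then show "AE x in \<mu>. (\<lambda>n. b n x) \<longlonglongrightarrow> c x"
  proof eventually_elim
    case (elim x)
    have "(\<lambda>n. b n x - c x) \<longlonglongrightarrow> 0"
    proof (rule Lim_null_comparison)
      show "\<forall>\<^sub>F n in sequentially. norm (b n x - c x) \<le> (1/2) ^ n"
        using elim by eventually_elim (use close in auto)
      show "(\<lambda>n. (1/2) ^ n :: real) \<longlonglongrightarrow> 0"
        by (intro LIMSEQ_realpow_zero) auto
    qed
    then show ?case
      by (rule LIM_zero_cancel)
  qed
qed

text \<open>Balanced continuous functions replace Urysohn functions: they form a ring that contains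
  the constants and separates points, hence almost separates disjoint closed subsets of a compact
  set. Regularity supplies a compact set of nearly full measure on which to work.\<close>

lemma balanced_indicator_compact:
  assumes K: "compact K"
  shows "balanced (indicator K)"
proof -
  have K_borel: "K \<in> sets borel"
    using K by (intro borel_closed compact_imp_closed)
  have "\<exists>b N. balanced b \<and> (\<forall>x. \<bar>b x\<bar> \<le> 1) \<and> N \<in> sets \<mu> \<and> measure \<mu> N \<le> (1/2) ^ n \<and>
      (\<forall>x. x \<notin> N \<longrightarrow> \<bar>b x - indicator K x\<bar> \<le> (1/2) ^ n)" for n
  proof -
    \<comment> \<open>Half of the allowed error, because two exceptional sets of measure below
      \<open>e\<close> are united in \<open>N\<close>.\<close>
    define e :: real where "e = (1/2) ^ Suc n"
    have e: "0 < e" "e < 1"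
      using power_le_one[of "1/2 :: real" n] by (simp_all add: e_def)
    obtain U where U: "open U" "K \<subseteq> U" "measure \<mu> (U - K) < e"
      using outer_approximation[OF K_borel e(1)] .
    obtain L where L: "compact L" "measure \<mu> (UNIV - L) < e"
      using inner_approximation[of UNIV, OF _ e(1)] by auto
    have L_borel: "L \<in> sets borel"
      using L(1) by (intro borel_closed compact_imp_closed)
    define R where "R = {b. balanced b \<and> continuous_on UNIV b}"
    interpret function_ring_on R "L \<union> K"
    proof
      show "compact (L \<union> K)"
        by (rule compact_Un[OF L(1) K])
      show "continuous_on (L \<union> K) f" if "f \<in> R" for f
        using that by (auto simp: R_def intro: continuous_on_subset)
      show "\<exists>f\<in>R. f x \<noteq> f y" if "x \<noteq> y" for x y
        using separating_balanced[OF that] by (auto simp: R_def)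
    qed (auto simp: R_def balanced_const balanced_add balanced_mult intro: continuous_intros)
    have "closed (L \<union> K - U)"
      using compact U(1) by (intro closed_Diff compact_imp_closed)
    \<comment> \<open>\<open>two\<close> is the separation lemma behind the Stone-Weierstrass
      theorem: \<open>f\<close> is nearly 1 on \<open>K\<close> and nearly 0 on the part of the
      compact set outside \<open>U\<close>.\<close>
    then obtain f where f: "f \<in> R" "f ` (L \<union> K) \<subseteq> {0..1}"
      "\<forall>x\<in>L \<union> K - U. f x < e" "\<forall>x\<in>K. f x > 1 - e"
      using two[of "L \<union> K - U" K e] K U(2) e compact_imp_closed by blast
    \<comment> \<open>\<open>f\<close> is controlled only on the union of \<open>L\<close> and
      \<open>K\<close>. Clipping to [0, 1] bounds it everywhere, changes nothing on that union and
      keeps the function balanced.\<close>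
    define b where "b x = max 0 (min 1 (f x))" for x
    define N where "N = (U - K) \<union> (UNIV - L)"
    have "balanced b"
      unfolding b_def
      by (rule balanced_continuous[where C = 1]) (use f(1) in \<open>auto simp: R_def intro!: continuous_intros\<close>)
    moreover have "\<bar>b x\<bar> \<le> 1" for x
      by (simp add: b_def)
    moreover have N_sets: "U - K \<in> sets \<mu>" "UNIV - L \<in> sets \<mu>"
      using U(1) K_borel L_borel by (auto simp: sets_eq intro!: sets.Diff)
    moreover have "measure \<mu> N \<le> (1/2) ^ n"
    proof -
      have "measure \<mu> N \<le> measure \<mu> (U - K) + measure \<mu> (UNIV - L)"
        unfolding N_def by (rule measure_Un_le[OF N_sets])
      also have "\<dots> \<le> e + e"
        using U(3) L(2) by linarith
      finally show ?thesis
        by (simp add: e_def)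
    qed
    moreover have "\<bar>b x - indicator K x\<bar> \<le> (1/2) ^ n" if x: "x \<notin> N" for x
    proof -
      have "\<bar>b x - indicator K x\<bar> \<le> e"
      proof (cases "x \<in> K")
        case True
        then show ?thesis
          using f(4) e by (auto simp: b_def)
      next
        case False
        then have "x \<in> L \<union> K - U"
          using x by (auto simp: N_def)
        then have "f x < e" "0 \<le> f x"
          using f(2,3) by auto
        then show ?thesis
          using False e by (auto simp: b_def)
      qed
      also have "e \<le> (1/2) ^ n"
        by (simp add: e_def)
      finally show ?thesis .
    qed
    ultimately show ?thesis
      unfolding N_def by blast
  qed
  then obtain b N where b: "\<And>n. balanced (b n)" "\<And>n x. \<bar>b n x\<bar> \<le> 1"
    and N: "\<And>n. N n \<in> sets \<mu>" "\<And>n. measure \<mu> (N n) \<le> (1/2) ^ n"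
      "\<And>n x. x \<notin> N n \<Longrightarrow> \<bar>b n x - indicator K x\<bar> \<le> (1/2) ^ n"
    by metis
  show ?thesis
    by (rule balanced_borel_cantelli[OF b _ _ N])
      (use K_borel in \<open>auto simp: sets_eq split: split_indicator intro!: borel_measurable_indicator\<close>)
qed

text \<open>Inner regularity: the indicator of a compact \<open>K n\<close> inside \<open>E\<close>
  is wrong only on \<open>E - K n\<close>, whose measure is below (1/2)^n.\<close>

lemma balanced_indicator:
  assumes E: "E \<in> sets \<mu>"
  shows "balanced (indicator E)"
proof -
  have "\<exists>K. compact K \<and> K \<subseteq> E \<and> measure \<mu> (E - K) < (1/2) ^ n" for n
  proof -
    have "E \<in> sets borel" "0 < (1/2 :: real) ^ n"
      using E by (simp_all add: sets_eq)
    then show ?thesis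
      by (rule inner_approximation) blast
  qed
  then obtain K where K: "\<And>n. compact (K n)" "\<And>n. K n \<subseteq> E" "\<And>n. measure \<mu> (E - K n) < (1/2) ^ n"
    by metis
  have "K n \<in> sets \<mu>" for n
    unfolding sets_eq by (intro borel_closed compact_imp_closed K)
  then show ?thesis
    using K E
    by (intro balanced_borel_cantelli[of "\<lambda>n. indicator (K n)" 1 "indicator E" "\<lambda>n. E - K n"]
        balanced_indicator_compact)
      (auto simp: indicator_def less_imp_le)
qed

lemma balanced_bounded:
  assumes "b \<in> borel_measurable \<mu>" "\<And>x. 0 \<le> b x" "\<And>x. b x \<le> C"
  shows "balanced b"
proof -
  \<comment> \<open>Boundedness is carried as a premise through the induction because
    \<open>balanced\<close> demands it. Nonnegativity passes a bound of a sum or of an increasing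
    limit on to each constituent.\<close>
  have "(\<exists>C. \<forall>x. b x \<le> C) \<longrightarrow> balanced b"
    using assms(1,2)
  proof (induction rule: borel_measurable_induct_real)
    case (set E)
    then show ?case
      by (simp add: balanced_indicator)
  next
    case (mult u c)
    show ?case
    proof (cases "c = 0")
      case True
      then show ?thesis
        by (simp add: balanced_const)
    next
      case False
      show ?thesis
      proof
        assume "\<exists>C. \<forall>x. c * u x \<le> C"
        then obtain C where "c * u x \<le> C" for x
          by blast
        then have "u x \<le> C / c" for x
          using mult(1) False by (simp add: field_simps)
        then show "balanced (\<lambda>x. c * u x)"
          using mult.IH by (auto intro!: balanced_mult balanced_const)
      qed
    qed
  next
    case (add u v)
    show ?case
    proof
      assume "\<exists>C. \<forall>x. v x + u x \<le> C"
      then obtain C where C: "v x + u x \<le> C" for x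
        by blast
      have "u x \<le> C" "v x \<le> C" for x
        using C[of x] add.hyps(2,4)[of x] by linarith+
      then show "balanced (\<lambda>x. v x + u x)"
        using add.IH by (auto intro!: balanced_add)
    qed
  next
    case (seq U)
    show ?case
    proof
      assume "\<exists>C. \<forall>x. b x \<le> C"
      then obtain C where C: "b x \<le> C" for x
        by blast
      have lim: "(\<lambda>i. U i x) \<longlonglongrightarrow> b x" for x
        using seq.hyps space_eq by simp
      have "U i x \<le> b x" for i x
        using lim[of x] \<open>incseq U\<close> by (intro incseq_le) (auto simp: incseq_def le_fun_def)
      then have UC: "U i x \<le> C" for i x
        using C order_trans by blast
      show "balanced b"
      proof (rule balanced_limit[where b = U and C = C])
        show "balanced (U i)" for i
          using seq.IH UC by blast
        show "\<bar>U i x\<bar> \<le> C" for i x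
          using UC[of i x] seq.hyps(2)[of i x] by simp
        show "\<bar>b x\<bar> \<le> C" for x
          using C[of x] assms(2)[of x] by simp
      qed (use assms(1) lim in auto)
    qed
  qed
  then show ?thesis
    using assms(3) by blast
qed

text \<open>Moving the weight \<open>b\<^sup>2 = (q + e) / (p + e)\<close> from one side to the other balances the two factors of
  the Cauchy-Schwarz bound; \<open>e\<close> keeps \<open>b\<close> and \<open>1 / b\<close> bounded.\<close>

lemma B_le_integral:
  assumes p: "p \<in> borel_measurable \<mu>" "\<And>x. 0 \<le> p x" "\<And>x. p x \<le> C"
    and q: "q \<in> borel_measurable \<mu>" "\<And>x. 0 \<le> q x" "\<And>x. q x \<le> C"
  shows "cmod (B (\<lambda>x. of_real (p x)) (\<lambda>x. of_real (q x))) \<le> (\<integral>x. p x * q x \<partial>\<mu>)"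
proof -
  have integrable: "integrable \<mu> f" if "f \<in> borel_measurable \<mu>" "\<And>x. \<bar>f x\<bar> \<le> c" for f :: "'x \<Rightarrow> real" and c
    using that by (intro integrable_const_bound[where B = c]) auto
  have pI: "integrable \<mu> p" and qI: "integrable \<mu> q"
    using p q by (auto intro!: integrable[where c = C])
  have pqI: "integrable \<mu> (\<lambda>x. p x * q x)"
  proof (rule integrable)
    show "\<bar>p x * q x\<bar> \<le> C * C" for x
      using p(2,3)[of x] q(2,3)[of x] by (simp add: abs_mult mult_mono)
  qed (use p q in measurable)
  define I M where "I = (\<integral>x. p x * q x \<partial>\<mu>)" and "M = (\<integral>x. p x \<partial>\<mu>) + (\<integral>x. q x \<partial>\<mu>)"
  have int0: "0 \<le> (\<integral>x. p x \<partial>\<mu>)" "0 \<le> (\<integral>x. q x \<partial>\<mu>)" "0 \<le> I"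
    unfolding I_def using p q by (auto intro!: integral_nonneg_AE)
  have key: "cmod (B (\<lambda>x. of_real (p x)) (\<lambda>x. of_real (q x))) \<le> I + e * M" if e: "0 < e" for e
  proof -
    have nonneg: "0 \<le> I + e * M"
      using int0 e unfolding M_def by (intro add_nonneg_nonneg mult_nonneg_nonneg) auto
    define b where "b x = sqrt ((q x + e) / (p x + e))" for x
    have pos: "0 < p x + e" "0 < q x + e" for x
      using p(2)[of x] q(2)[of x] e by auto
    have b_pos: "0 < b x" for x
      using pos[of x] by (simp add: b_def)
    have b_sq: "(b x)\<^sup>2 = (q x + e) / (p x + e)" for x
      using pos[of x] by (simp add: b_def)
    have b_meas [measurable]: "b \<in> borel_measurable \<mu>"
      unfolding b_def using p q by measurable
    have b: "balanced b"
    proof (rule balanced_bounded)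
      show "b x \<le> sqrt ((C + e) / e)" for x
        unfolding b_def using p(2)[of x] q(2,3)[of x] e by (intro real_sqrt_le_mono frac_le) auto
    qed (use b_pos in \<open>auto intro: less_imp_le\<close>)
    \<comment> \<open>The square is q^2 (p + e)/(q + e), and the factor q/(q + e) is at most 1. The
      same cancellation gives the two integral bounds below.\<close>
    have qb_le: "q x / b x \<le> sqrt (C * (C + e))" for x
    proof (rule real_le_rsqrt)
      have "(q x / b x)\<^sup>2 = (q x / (q x + e)) * (q x * (p x + e))"
        unfolding power_divide b_sq by (simp add: power2_eq_square)
      also have "\<dots> \<le> 1 * (q x * (p x + e))"
        using pos[of x] q(2)[of x] e by (intro mult_right_mono) (auto simp: divide_le_eq)
      also have "\<dots> \<le> C * (C + e)"
        using p(3)[of x] q(2,3)[of x] pos[of x] by (auto intro!: mult_mono)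
      finally show "(q x / b x)\<^sup>2 \<le> C * (C + e)" .
    qed
    have D: "(\<lambda>x. of_real (p x)) \<in> D" "(\<lambda>x. of_real (q x / b x)) \<in> D"
    proof -
      show "(\<lambda>x. of_real (p x)) \<in> D"
        by (rule bounded_in_D[where C = C]) (use p in auto)
      have "cmod (of_real (q x / b x)) \<le> sqrt (C * (C + e))" for x
        using qb_le[of x] b_pos[of x] q(2)[of x] by (simp only: norm_of_real) simp
      then show "(\<lambda>x. of_real (q x / b x)) \<in> D"
        by (rule bounded_in_D[rotated]) (use q in measurable)
    qed
    have bound1: "(\<integral>x. (cmod (of_real (b x) * of_real (p x)))\<^sup>2 \<partial>\<mu>) \<le> I + e * M"
    proof -
      have "(\<integral>x. (cmod (of_real (b x) * of_real (p x)))\<^sup>2 \<partial>\<mu>) \<le> (\<integral>x. p x * q x + e * p x \<partial>\<mu>)"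
      proof (rule integral_mono)
        show "integrable \<mu> (\<lambda>x. (cmod (of_real (b x) * of_real (p x)))\<^sup>2)"
          using D_square_integrable[OF D_mult_balanced[OF D(1) b]] .
        show "integrable \<mu> (\<lambda>x. p x * q x + e * p x)"
          using pqI pI by auto
        fix x
        have "(cmod (of_real (b x) * of_real (p x)))\<^sup>2 = (b x)\<^sup>2 * (p x)\<^sup>2"
          by (simp add: norm_mult power_mult_distrib)
        also have "\<dots> = (p x / (p x + e)) * (p x * (q x + e))"
          unfolding b_sq by (simp add: power2_eq_square)
        also have "\<dots> \<le> 1 * (p x * (q x + e))"
          using pos[of x] p(2)[of x] e by (intro mult_right_mono) (auto simp: divide_le_eq)
        finally show "(cmod (of_real (b x) * of_real (p x)))\<^sup>2 \<le> p x * q x + e * p x"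
          by (simp add: algebra_simps)
      qed
      also have "\<dots> = I + e * (\<integral>x. p x \<partial>\<mu>)"
        using pqI pI by (simp add: I_def)
      also have "\<dots> \<le> I + e * M"
        using int0 e by (simp add: M_def)
      finally show ?thesis .
    qed
    have bound2: "(\<integral>x. (cmod (of_real (q x / b x)))\<^sup>2 \<partial>\<mu>) \<le> I + e * M"
    proof -
      have "(\<integral>x. (cmod (of_real (q x / b x)))\<^sup>2 \<partial>\<mu>) \<le> (\<integral>x. p x * q x + e * q x \<partial>\<mu>)"
      proof (rule integral_mono)
        show "integrable \<mu> (\<lambda>x. (cmod (of_real (q x / b x)))\<^sup>2)"
          using D_square_integrable[OF D(2)] .
        show "integrable \<mu> (\<lambda>x. p x * q x + e * q x)"
          using pqI qI by auto
        fix x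
        have "(cmod (of_real (q x / b x)))\<^sup>2 = (q x / b x)\<^sup>2"
          by (simp only: norm_of_real power2_abs)
        also have "\<dots> = (q x / (q x + e)) * (q x * (p x + e))"
          unfolding power_divide b_sq by (simp add: power2_eq_square)
        also have "\<dots> \<le> 1 * (q x * (p x + e))"
          using pos[of x] q(2)[of x] e by (intro mult_right_mono) (auto simp: divide_le_eq)
        finally show "(cmod (of_real (q x / b x)))\<^sup>2 \<le> p x * q x + e * q x"
          by (simp add: algebra_simps)
      qed
      also have "\<dots> = I + e * (\<integral>x. q x \<partial>\<mu>)"
        using pqI qI by (simp add: I_def)
      also have "\<dots> \<le> I + e * M"
        using int0 e by (simp add: M_def)
      finally show ?thesis .
    qed
    \<comment> \<open>Here the weight changes sides: \<open>q\<close> is read as \<open>b\<close>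
      times q / b, and balancedness moves \<open>b\<close> onto \<open>p\<close>.\<close>
    have "of_real (b x) * of_real (q x / b x) = (of_real (q x) :: complex)" for x
      using less_imp_neq[OF b_pos[of x]] by simp
    then have "B (\<lambda>x. of_real (p x)) (\<lambda>x. of_real (q x)) =
        B (\<lambda>x. of_real (b x) * of_real (p x)) (\<lambda>x. of_real (q x / b x))"
      using balancedD[OF b D] by simp
    also have "cmod \<dots> \<le> L2_norm (\<lambda>x. of_real (b x) * of_real (p x)) * L2_norm (\<lambda>x. of_real (q x / b x))"
      by (rule B_bound[OF D_mult_balanced[OF D(1) b] D(2)])
    also have "\<dots> \<le> sqrt (I + e * M) * sqrt (I + e * M)"
      using nonneg by (intro mult_mono real_sqrt_le_mono bound1 bound2) auto
    also have "\<dots> = I + e * M"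
      using nonneg by simp
    finally show ?thesis .
  qed
  have "cmod (B (\<lambda>x. of_real (p x)) (\<lambda>x. of_real (q x))) \<le> I + e" if e: "0 < e" for e
  proof -
    have M: "0 \<le> M"
      using int0 by (simp add: M_def)
    \<comment> \<open>The parameter is rescaled to absorb the factor \<open>M\<close> of the error
      term; M + 1 avoids division by zero.\<close>
    then have "e / (M + 1) * M \<le> e"
      using e by (simp add: field_simps)
    then show ?thesis
      using key[of "e / (M + 1)"] e M by simp
  qed
  then show ?thesis
    unfolding I_def by (rule field_le_epsilon)
qed

end

section \<open>Transition probability\<close>

context function_algebra
begin

abbreviation (input) \<A> where "\<A> \<equiv> cont_functions\<lparr>carrier := A\<rparr>"

lemma algebra_simps_A:
  "carrier \<A> = A" "monoid.mult \<A> = (\<lambda>a b x. a x * b x)"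
  "add \<A> = (\<lambda>a b x. a x + b x)" "smult \<A> = (\<lambda>c a x. c * a x)"
  "star \<A> = (\<lambda>a x. cnj (a x))"
  by (simp_all add: cont_functions_def)

text \<open>\<open>Q\<close> is the adjoint of the isometry \<open>e a \<mapsto> a p\<close>.\<close>

lemma gns_coisometry:
  fixes H :: "('v, 'n) ip_space_scheme"
  assumes gns: "self_adjoint_gns \<A> H f e"
    and p: "p \<in> D" and f: "\<And>a. a \<in> A \<Longrightarrow> f a = (\<integral>x. a x * p x * cnj (p x) \<partial>\<mu>)"
  obtains Q where "\<And>u. u \<in> D \<Longrightarrow> Q u \<in> carrier H"
    and "\<And>u v. \<lbrakk>u \<in> D; v \<in> D\<rbrakk> \<Longrightarrow> Q (\<lambda>x. u x + v x) = Q u \<oplus>\<^bsub>H\<^esub> Q v"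
    and "\<And>u c. u \<in> D \<Longrightarrow> Q (\<lambda>x. c * u x) = c \<odot>\<^bsub>H\<^esub> Q u"
    and "\<And>u. u \<in> D \<Longrightarrow> ip_norm H (Q u) \<le> L2_norm u"
    and "\<And>u. u \<in> D \<Longrightarrow> adjoint_orbit \<A> H e (Q u) (\<lambda>a. Q (\<lambda>x. a x * u x))"
    and "Q p = e (\<lambda>x. 1)"
proof -
  interpret H: self_adjoint_gns \<A> H f e by fact
  note A = algebra_simps_A
  note e_closed = H.e_closed[unfolded A] and e_add = H.e_add[unfolded A]
    and e_smult = H.e_smult[unfolded A] and ip_e = H.ip_e[unfolded A] and eqI = H.eqI[unfolded A]
  have ap: "(\<lambda>x. a x * p x) \<in> D" if "a \<in> A" for a
    using p that by (rule D_mult_A)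
  have norm_e: "ip_norm H (e a) = L2_norm (\<lambda>x. a x * p x)" if "a \<in> A" for a
  proof -
    have "ip H (e a) (e a) = (\<integral>x. (a x * p x) * cnj (a x * p x) \<partial>\<mu>)"
      using that by (simp add: ip_e f A_mult A_cnj mult_ac)
    also note ip_self_eq
    finally show ?thesis
      by (simp add: ip_norm_def)
  qed
  have "\<exists>z. z \<in> carrier H \<and> (\<forall>a\<in>carrier \<A>. (\<integral>x. (a x * p x) * cnj (u x) \<partial>\<mu>) = ip H (e a) z)
      \<and> ip_norm H z \<le> L2_norm u" if u: "u \<in> D" for u
  proof (rule H.riesz, unfold A)
    show "(\<integral>x. ((a x + b x) * p x) * cnj (u x) \<partial>\<mu>) =
        (\<integral>x. (a x * p x) * cnj (u x) \<partial>\<mu>) + (\<integral>x. (b x * p x) * cnj (u x) \<partial>\<mu>)"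
      if "a \<in> A" "b \<in> A" for a b
      using D_ip_integrable[OF ap u] that by (simp add: distrib_right)
    show "(\<integral>x. ((c * a x) * p x) * cnj (u x) \<partial>\<mu>) = c * (\<integral>x. (a x * p x) * cnj (u x) \<partial>\<mu>)"
      if "a \<in> A" for a c
      by (simp add: mult.assoc)
    show "cmod (\<integral>x. (a x * p x) * cnj (u x) \<partial>\<mu>) \<le> L2_norm u * ip_norm H (e a)" if "a \<in> A" for a
      using L2_cauchy_schwarz[OF ap[OF that] u] that by (simp add: norm_e mult.commute)
  qed simp
  then have "\<forall>u\<in>D. \<exists>z. z \<in> carrier H \<and>
      (\<forall>a\<in>A. (\<integral>x. (a x * p x) * cnj (u x) \<partial>\<mu>) = ip H (e a) z) \<and> ip_norm H z \<le> L2_norm u"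
    unfolding A by blast
  from bchoice[OF this] obtain Q where Q': "\<forall>u\<in>D. Q u \<in> carrier H \<and>
      (\<forall>a\<in>A. (\<integral>x. (a x * p x) * cnj (u x) \<partial>\<mu>) = ip H (e a) (Q u)) \<and> ip_norm H (Q u) \<le> L2_norm u"
    by blast
  have Q_closed: "Q u \<in> carrier H" and Q_norm: "ip_norm H (Q u) \<le> L2_norm u" if "u \<in> D" for u
    using Q' that by blast+
  have Q: "ip H (e a) (Q u) = (\<integral>x. (a x * p x) * cnj (u x) \<partial>\<mu>)" if "u \<in> D" "a \<in> A" for u a
    by (rule sym) (use Q' that in blast)
  show thesis
  proof (rule that[OF Q_closed _ _ Q_norm])
    show "Q (\<lambda>x. u x + v x) = Q u \<oplus>\<^bsub>H\<^esub> Q v" if uv: "u \<in> D" "v \<in> D" for u v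
    proof (rule eqI)
      show "ip H (e a) (Q (\<lambda>x. u x + v x)) = ip H (e a) (Q u \<oplus>\<^bsub>H\<^esub> Q v)" if a: "a \<in> A" for a
        using uv a D_ip_integrable[OF ap[OF a]]
        by (simp add: Q Q_closed D_add e_closed H.H.ip_add_right distrib_left)
    qed (use uv Q_closed D_add in auto)
    show "Q (\<lambda>x. c * u x) = c \<odot>\<^bsub>H\<^esub> Q u" if u: "u \<in> D" for u c
    proof (rule eqI)
      show "ip H (e a) (Q (\<lambda>x. c * u x)) = ip H (e a) (c \<odot>\<^bsub>H\<^esub> Q u)" if a: "a \<in> A" for a
      proof -
        have "(\<integral>x. (a x * p x) * cnj (c * u x) \<partial>\<mu>) = (\<integral>x. cnj c * ((a x * p x) * cnj (u x)) \<partial>\<mu>)"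
          by (simp add: mult_ac)
        also have "\<dots> = cnj c * (\<integral>x. (a x * p x) * cnj (u x) \<partial>\<mu>)"
          by (rule integral_mult_right_zero)
        finally show ?thesis
          using u a by (simp only: Q Q_closed D_smult e_closed H.H.ip_smult_right)
      qed
    qed (use u Q_closed D_smult in auto)
    show "adjoint_orbit \<A> H e (Q u) (\<lambda>a. Q (\<lambda>x. a x * u x))" if u: "u \<in> D" for u
      unfolding adjoint_orbit_def A
    proof (intro conjI ballI)
      show "Q u \<in> carrier H"
        by (rule Q_closed[OF u])
      fix a b assume a: "a \<in> A" and b: "b \<in> A"
      show "Q (\<lambda>x. a x * u x) \<in> carrier H"
        by (rule Q_closed[OF D_mult_A[OF u a]])
      show "ip H (e (\<lambda>x. cnj (a x) * b x)) (Q u) = ip H (e b) (Q (\<lambda>x. a x * u x))"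
        using u a b by (simp add: Q A_mult A_cnj D_mult_A mult_ac)
    qed
    \<comment> \<open>Paired with \<open>e a\<close>, both sides give f a. So \<open>Q\<close>
      returns the cyclic vector, and no part of \<open>p\<close> is lost in the compression.\<close>
    show "Q p = e (\<lambda>x. 1)"
    proof (rule eqI)
      show "ip H (e a) (Q p) = ip H (e a) (e (\<lambda>x. 1))" if "a \<in> A" for a
        using that p one_A by (simp add: Q ip_e f)
    qed (use Q_closed p e_closed one_A in auto)
  qed
qed

text \<open>Both \<open>Q\<close> and \<open>P\<close> send \<open>D\<close> into the adjoint
  domains, where \<open>T\<close> intertwines; this is the only source of \<open>B_commutes\<close>.
  At \<open>p\<close> and \<open>q\<close> the compressed form sees the cyclic vectors, where
  \<open>T\<close> reproduces the given inner product.\<close>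

lemma transition_le:
  fixes H :: "('v, 'n) ip_space_scheme" and K :: "('w, 'l) ip_space_scheme"
    and V :: "('u, 'k) ip_space_scheme" and p q :: "'x \<Rightarrow> real"
  assumes separating: "\<And>x y. x \<noteq> y \<Longrightarrow> \<exists>a\<in>A. a x \<noteq> a y"
    and regular: "regular_borel_measure \<mu>"
    and H: "self_adjoint_gns \<A> H f e" and K: "self_adjoint_gns \<A> K g d"
    and p: "p \<in> borel_measurable \<mu>" "\<And>x. 0 \<le> p x" "\<And>x. p x \<le> C"
    and q: "q \<in> borel_measurable \<mu>" "\<And>x. 0 \<le> q x" "\<And>x. q x \<le> C"
    and f: "\<And>a. a \<in> A \<Longrightarrow> f a = (\<integral>x. a x * of_real (p x) * cnj (of_real (p x)) \<partial>\<mu>)"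
    and g: "\<And>a. a \<in> A \<Longrightarrow> g a = (\<integral>x. a x * of_real (q x) * cnj (of_real (q x)) \<partial>\<mu>)"
    and R: "star_rep \<A> V \<pi>" and \<phi>: "\<phi> \<in> representing_vectors \<A> V \<pi> f"
    and \<psi>: "\<psi> \<in> representing_vectors \<A> V \<pi> g"
  shows "cmod (ip V \<phi> \<psi>) \<le> (\<integral>x. p x * q x \<partial>\<mu>)"
proof -
  interpret H: self_adjoint_gns \<A> H f e by fact
  interpret K: self_adjoint_gns \<A> K g d by fact
  interpret R: star_rep \<A> V \<pi> by fact
  note A = algebra_simps_A
  have pD: "(\<lambda>x. of_real (p x)) \<in> D"
    by (rule bounded_in_D[where C = C]) (use p in auto)
  have qD: "(\<lambda>x. of_real (q x)) \<in> D"
    by (rule bounded_in_D[where C = C]) (use q in auto)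
  obtain Q where Q: "\<And>u. u \<in> D \<Longrightarrow> Q u \<in> carrier H"
    "\<And>u v. \<lbrakk>u \<in> D; v \<in> D\<rbrakk> \<Longrightarrow> Q (\<lambda>x. u x + v x) = Q u \<oplus>\<^bsub>H\<^esub> Q v"
    "\<And>u c. u \<in> D \<Longrightarrow> Q (\<lambda>x. c * u x) = c \<odot>\<^bsub>H\<^esub> Q u"
    and Q_norm: "\<And>u. u \<in> D \<Longrightarrow> ip_norm H (Q u) \<le> L2_norm u"
    and Q_orbit: "\<And>u. u \<in> D \<Longrightarrow> adjoint_orbit \<A> H e (Q u) (\<lambda>a. Q (\<lambda>x. a x * u x))"
    and Q_p: "Q (\<lambda>x. of_real (p x)) = e (\<lambda>x. 1)"
    by (rule gns_coisometry[OF H pD f]) blast+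
  obtain P where P: "\<And>u. u \<in> D \<Longrightarrow> P u \<in> carrier K"
    "\<And>u v. \<lbrakk>u \<in> D; v \<in> D\<rbrakk> \<Longrightarrow> P (\<lambda>x. u x + v x) = P u \<oplus>\<^bsub>K\<^esub> P v"
    "\<And>u c. u \<in> D \<Longrightarrow> P (\<lambda>x. c * u x) = c \<odot>\<^bsub>K\<^esub> P u"
    and P_norm: "\<And>u. u \<in> D \<Longrightarrow> ip_norm K (P u) \<le> L2_norm u"
    and P_orbit: "\<And>u. u \<in> D \<Longrightarrow> adjoint_orbit \<A> K d (P u) (\<lambda>a. P (\<lambda>x. a x * u x))"
    and P_q: "P (\<lambda>x. of_real (q x)) = d (\<lambda>x. 1)"
    by (rule gns_coisometry[OF K qD g]) blast+
  obtain T where T: "\<And>h. h \<in> carrier H \<Longrightarrow> T h \<in> carrier K"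
    "\<And>h h'. \<lbrakk>h \<in> carrier H; h' \<in> carrier H\<rbrakk> \<Longrightarrow> T (h \<oplus>\<^bsub>H\<^esub> h') = T h \<oplus>\<^bsub>K\<^esub> T h'"
    "\<And>h c. h \<in> carrier H \<Longrightarrow> T (c \<odot>\<^bsub>H\<^esub> h) = c \<odot>\<^bsub>K\<^esub> T h"
    and T_norm: "\<And>h. h \<in> carrier H \<Longrightarrow> ip_norm K (T h) \<le> ip_norm H h"
    and T_e: "\<And>a b. \<lbrakk>a \<in> carrier \<A>; b \<in> carrier \<A>\<rbrakk> \<Longrightarrow> ip K (T (e a)) (d b) = ip V (\<pi> a \<phi>) (\<pi> b \<psi>)"
    and T_orbit: "\<And>h k h' k' a. \<lbrakk>adjoint_orbit \<A> H e h k; adjoint_orbit \<A> K d h' k'; a \<in> carrier \<A>\<rbrakk>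
      \<Longrightarrow> ip K (T (k (star \<A> a))) h' = ip K (T h) (k' a)"
    by (rule intertwiner[OF H K R \<phi> \<psi>]) blast
  define B where "B u v = ip K (T (Q u)) (P v)" for u v
  interpret commuting_form A \<mu> B
  proof
    show "\<exists>a\<in>A. a x \<noteq> a y" if "x \<noteq> y" for x y
      using separating[OF that] .
    show "regular_borel_measure \<mu>"
      by (rule regular)
    show "B (\<lambda>x. u x + u' x) v = B u v + B u' v" if "u \<in> D" "u' \<in> D" "v \<in> D" for u u' v
      using that by (simp add: B_def Q T P K.H.ip_add_left)
    show "B u (\<lambda>x. v x + v' x) = B u v + B u v'" if "u \<in> D" "v \<in> D" "v' \<in> D" for u v v'
      using that by (simp add: B_def Q T P K.H.ip_add_right)
    show "B (\<lambda>x. c * u x) v = c * B u v" if "u \<in> D" "v \<in> D" for u v c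
      using that by (simp add: B_def Q T P K.H.ip_smult_left)
    show "B u (\<lambda>x. c * v x) = cnj c * B u v" if "u \<in> D" "v \<in> D" for u v c
      using that by (simp add: B_def Q T P K.H.ip_smult_right)
    show "cmod (B u v) \<le> L2_norm u * L2_norm v" if uv: "u \<in> D" "v \<in> D" for u v
    proof -
      have "cmod (B u v) \<le> ip_norm K (T (Q u)) * ip_norm K (P v)"
        unfolding B_def using uv by (intro K.H.cauchy_schwarz T Q P)
      also have "\<dots> \<le> L2_norm u * L2_norm v"
        using uv T_norm[OF Q(1)] Q_norm P_norm
        by (intro mult_mono K.H.ip_norm_nonneg T Q P) (auto intro: order_trans)
      finally show ?thesis .
    qed
    \<comment> \<open>The intertwining relation is applied to the conjugate of \<open>a\<close>,
      whose star is \<open>a\<close> again.\<close>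
    show "B (\<lambda>x. a x * u x) v = B u (\<lambda>x. cnj (a x) * v x)" if "u \<in> D" "v \<in> D" "a \<in> A" for u v a
      using T_orbit[OF Q_orbit[OF that(1)] P_orbit[OF that(2)], of "\<lambda>x. cnj (a x)"] A_cnj[OF that(3)]
      by (simp add: A B_def)
  qed
  have "B (\<lambda>x. of_real (p x)) (\<lambda>x. of_real (q x)) = ip V (\<pi> (\<lambda>x. 1) \<phi>) (\<pi> (\<lambda>x. 1) \<psi>)"
    unfolding B_def Q_p P_q by (rule T_e) (simp_all add: A one_A)
  also have "\<dots> = ip V \<phi> \<psi>"
    using R.rep_one[of \<phi>] R.rep_one[of \<psi>] \<phi> \<psi>
    by (simp add: representing_vectors_def cont_functions_def)
  finally show ?thesis
    using B_le_integral[OF p q] by simp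
qed

lemma mult_rep_representing_vector:
  fixes p :: "'x \<Rightarrow> real"
  assumes p: "(\<lambda>x. of_real (p x)) \<in> D"
    and f: "\<And>a. a \<in> A \<Longrightarrow> f a = (\<integral>x. a x * of_real (p x) * cnj (of_real (p x)) \<partial>\<mu>)"
  shows "ae_class \<mu> (\<lambda>x. of_real (p x)) \<in> representing_vectors \<A> (mult_space \<mu> A) (mult_rep \<mu>) f"
  using p f by (auto simp: representing_vectors_def algebra_simps_A carrier_mult_space mult_rep_ae_class
      ip_ae_class D_mult_A)

end

text \<open>Nonnegativity and boundedness hold only almost everywhere, while the estimates on
  multipliers are pointwise; the square root is therefore taken of a truncated version of
  \<open>h\<close>.\<close>

lemma bounded_square_root:
  assumes "h \<in> L_infinity \<mu>" "AE x in \<mu>. 0 \<le> h x"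
  obtains p C where "p \<in> borel_measurable \<mu>" "\<And>x. 0 \<le> p x" "\<And>x. p x \<le> C"
    "AE x in \<mu>. p x = sqrt (h x)"
    "\<And>a. a \<in> borel_measurable \<mu> \<Longrightarrow>
      density_functional \<mu> h a = (\<integral>x. a x * of_real (p x) * cnj (of_real (p x)) \<partial>\<mu>)"
proof -
  have h: "h \<in> borel_measurable \<mu>"
    using assms(1) by (simp add: L_infinity_def)
  obtain C where C: "AE x in \<mu>. \<bar>h x\<bar> \<le> C"
    using assms(1) by (auto simp: L_infinity_def)
  \<comment> \<open>The absolute value of \<open>C\<close> guards against a negative
    \<open>C\<close>, which is possible if the measure is zero.\<close>
  define p where "p x = sqrt (max 0 (min \<bar>C\<bar> (h x)))" for x
  have p: "p \<in> borel_measurable \<mu>"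
    unfolding p_def using h by measurable
  have p_eq: "AE x in \<mu>. p x = sqrt (h x)"
    using C assms(2) by eventually_elim (auto simp: p_def)
  have "density_functional \<mu> h a = (\<integral>x. a x * of_real (p x) * cnj (of_real (p x)) \<partial>\<mu>)"
    if a: "a \<in> borel_measurable \<mu>" for a
    unfolding density_functional_def
  proof (rule integral_cong_AE)
    show "AE x in \<mu>. a x * complex_of_real (h x) = a x * of_real (p x) * cnj (of_real (p x))"
      using p_eq assms(2)
    proof eventually_elim
      case (elim x)
      then have "h x = p x * p x"
        by simp
      then show ?case
        by simp
    qed
  qed (use a h p in measurable)
  moreover have "0 \<le> p x" "p x \<le> sqrt \<bar>C\<bar>" for x
    by (auto simp: p_def)
  ultimately show thesis
    using p p_eq by (intro that[of p "sqrt \<bar>C\<bar>"])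
qed

theorem theorem12:
  fixes A :: "('x::t2_space \<Rightarrow> complex) set"
    and \<mu> :: "'x measure"
    and \<eta> \<xi> :: "'x \<Rightarrow> real"
    and V\<^sub>\<eta> H\<^sub>\<eta> :: "'v ip_space" and V\<^sub>\<xi> H\<^sub>\<xi> :: "'w ip_space"
  assumes "locally_compact_space (euclidean :: 'x topology)"
    and "star_subalgebra A cont_functions"
    and "(\<lambda>x. 1) \<in> A"
    and "\<And>x y. x \<noteq> y \<Longrightarrow> \<exists>a\<in>A. a x \<noteq> a y"
    and "regular_borel_measure \<mu>"
    and "\<And>a. a \<in> A \<Longrightarrow> integrable \<mu> a"
    and "\<eta> \<in> L_infinity \<mu>" and "AE x in \<mu>. 0 \<le> \<eta> x"
    and "\<xi> \<in> L_infinity \<mu>" and "AE x in \<mu>. 0 \<le> \<xi> x"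
    and "gns_rep (cont_functions\<lparr>carrier := A\<rparr>) (density_functional \<mu> \<eta>) V\<^sub>\<eta> \<pi>\<^sub>\<eta> \<phi>\<^sub>\<eta>"
    and "hilbert_completion V\<^sub>\<eta> H\<^sub>\<eta>"
    and "essentially_self_adjoint (cont_functions\<lparr>carrier := A\<rparr>) V\<^sub>\<eta> H\<^sub>\<eta> \<pi>\<^sub>\<eta>"
    and "gns_rep (cont_functions\<lparr>carrier := A\<rparr>) (density_functional \<mu> \<xi>) V\<^sub>\<xi> \<pi>\<^sub>\<xi> \<phi>\<^sub>\<xi>"
    and "hilbert_completion V\<^sub>\<xi> H\<^sub>\<xi>"
    and "essentially_self_adjoint (cont_functions\<lparr>carrier := A\<rparr>) V\<^sub>\<xi> H\<^sub>\<xi> \<pi>\<^sub>\<xi>"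
  shows "transition_probability TYPE(('x \<Rightarrow> complex) + 'd) (cont_functions\<lparr>carrier := A\<rparr>)
           (density_functional \<mu> \<eta>) (density_functional \<mu> \<xi>)
         = ereal ((\<integral>x. sqrt (\<eta> x) * sqrt (\<xi> x) \<partial>\<mu>)\<^sup>2)"
proof -
  interpret function_algebra A \<mu>
    using assms(2,3,6) by unfold_locales
  let ?f = "density_functional \<mu> \<eta>" and ?g = "density_functional \<mu> \<xi>"
  let ?A = "cont_functions\<lparr>carrier := A\<rparr>"
  obtain p C1 where p: "p \<in> borel_measurable \<mu>" "\<And>x. 0 \<le> p x" "\<And>x. p x \<le> C1"
    and p_eq: "AE x in \<mu>. p x = sqrt (\<eta> x)"
    and f: "\<And>a. a \<in> borel_measurable \<mu> \<Longrightarrow> ?f a = (\<integral>x. a x * of_real (p x) * cnj (of_real (p x)) \<partial>\<mu>)"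
    by (rule bounded_square_root[OF assms(7,8)]) blast
  obtain q C2 where q: "q \<in> borel_measurable \<mu>" "\<And>x. 0 \<le> q x" "\<And>x. q x \<le> C2"
    and q_eq: "AE x in \<mu>. q x = sqrt (\<xi> x)"
    and g: "\<And>a. a \<in> borel_measurable \<mu> \<Longrightarrow> ?g a = (\<integral>x. a x * of_real (q x) * cnj (of_real (q x)) \<partial>\<mu>)"
    by (rule bounded_square_root[OF assms(9,10)]) blast
  note fA = f[OF A_measurable] and gA = g[OF A_measurable]
  have p': "p x \<le> max C1 C2" and q': "q x \<le> max C1 C2" for x
    using p(3)[of x] q(3)[of x] by auto
  have pD: "(\<lambda>x. complex_of_real (p x)) \<in> D"
    by (rule bounded_in_D[where C = C1]) (use p in auto)
  have qD: "(\<lambda>x. complex_of_real (q x)) \<in> D"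
    by (rule bounded_in_D[where C = C2]) (use q in auto)
  define I where "I = (\<integral>x. p x * q x \<partial>\<mu>)"
  have I_eq: "(\<integral>x. sqrt (\<eta> x) * sqrt (\<xi> x) \<partial>\<mu>) = I"
    unfolding I_def
  proof (rule integral_cong_AE)
    show "AE x in \<mu>. sqrt (\<eta> x) * sqrt (\<xi> x) = p x * q x"
      using p_eq q_eq by eventually_elim simp
  qed (use assms(7,9) p q in \<open>auto simp: L_infinity_def\<close>)
  have H: "self_adjoint_gns ?A H\<^sub>\<eta> ?f (\<lambda>a. \<pi>\<^sub>\<eta> a \<phi>\<^sub>\<eta>)"
    using assms(11-13) by (rule self_adjoint_gnsI)
  have K: "self_adjoint_gns ?A H\<^sub>\<xi> ?g (\<lambda>a. \<pi>\<^sub>\<xi> a \<phi>\<^sub>\<xi>)"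
    using assms(14-16) by (rule self_adjoint_gnsI)
  have "transition_probability TYPE(('x \<Rightarrow> complex) + 'd) ?A ?f ?g = ereal (I\<^sup>2)"
    unfolding transition_probability_def
  proof (rule Sup_eqI)
    fix y
    assume "y \<in> {ereal ((cmod (ip V \<phi> \<psi>))\<^sup>2) |(V :: (('x \<Rightarrow> complex) + 'd) ip_space) \<pi> \<phi> \<psi>.
       star_rep ?A V \<pi> \<and> \<phi> \<in> representing_vectors ?A V \<pi> ?f \<and> \<psi> \<in> representing_vectors ?A V \<pi> ?g}"
    then obtain V :: "(('x \<Rightarrow> complex) + 'd) ip_space" and \<pi> \<phi> \<psi>
      where y: "y = ereal ((cmod (ip V \<phi> \<psi>))\<^sup>2)" and R: "star_rep ?A V \<pi>"
        "\<phi> \<in> representing_vectors ?A V \<pi> ?f" "\<psi> \<in> representing_vectors ?A V \<pi> ?g"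
      by blast
    have "cmod (ip V \<phi> \<psi>) \<le> I"
      unfolding I_def
      by (rule transition_le[OF assms(4,5) H K p(1,2) p' q(1,2) q' fA gA R])
    then show "y \<le> ereal (I\<^sup>2)"
      unfolding y by (simp add: power_mono)
  next
    fix y
    assume upper: "\<And>z. z \<in> {ereal ((cmod (ip V \<phi> \<psi>))\<^sup>2) |(V :: (('x \<Rightarrow> complex) + 'd) ip_space) \<pi> \<phi> \<psi>.
       star_rep ?A V \<pi> \<and> \<phi> \<in> representing_vectors ?A V \<pi> ?f \<and> \<psi> \<in> representing_vectors ?A V \<pi> ?g}
       \<Longrightarrow> z \<le> y"
    \<comment> \<open>The supremum is attained: this one representation carries vectors for both
      functionals whose inner product is exactly \<open>I\<close>.\<close>
    let ?V = "mult_space \<mu> A :: (('x \<Rightarrow> complex) + 'd) ip_space"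
    let ?p = "ae_class \<mu> (\<lambda>x. of_real (p x)) :: ('x \<Rightarrow> complex) + 'd"
    let ?q = "ae_class \<mu> (\<lambda>x. of_real (q x)) :: ('x \<Rightarrow> complex) + 'd"
    have "ip ?V ?p ?q = (\<integral>x. of_real (p x * q x) \<partial>\<mu>)"
      by (simp add: ip_ae_class[OF pD qD])
    also have "\<dots> = of_real I"
      unfolding I_def by (rule integral_complex_of_real)
    finally have "(cmod (ip ?V ?p ?q))\<^sup>2 = I\<^sup>2"
      by simp
    moreover have "ereal ((cmod (ip ?V ?p ?q))\<^sup>2) \<le> y"
      using star_rep_mult_rep mult_rep_representing_vector[OF pD fA] mult_rep_representing_vector[OF qD gA]
      by (intro upper) blast
    ultimately show "ereal (I\<^sup>2) \<le> y"
      by simp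
  qed
  then show ?thesis
    unfolding I_eq .
qed

end
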